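(* Let $\mathcal{C}_2$ be a finite family of two-dimensional spherical polyhedral cells in $S^2$ with pairwise disjoint interiors and $\sigma\left(S^2\setminus\bigcup_{C\in\mathcal{C}_2}\operatorname{int}C\right)=0$, and let $F:S^2\to\mathbb{R}$ be measurable such that for every $C\in\mathcal{C}_2$ there is a nonzero $a_C\in\mathbb{R}^3$ with $F(u)=a_C\cdot u$ on $\operatorname{int}C$. Put $D_C=\|a_C\|$, $\hat a_C=a_C/D_C$, choose an orthonormal basis $(\hat a_C,e_{C,1},e_{C,2})$ of $\mathbb{R}^3$, and for $|t|<D_C$ define $$u_C(t,\theta)=\frac{t}{D_C}\hat a_C+\sqrt{1-\frac{t^2}{D_C^2}}\left(\cos\theta\,e_{C,1}+\sin\theta\,e_{C,2}\right),\qquad \Omega_C=\{(t,\theta):|t|<D_C,\ u_C(t,\theta)\in\operatorname{int}C\}.$$ Let $U$ be uniformly distributed on $S^2$. If $g:\mathbb{R}\to[0,\infty]$ is Borel measurable, then $$\mathbb{E}\,g(F(U))=\frac{1}{4\pi}\sum_{C\in\mathcal{C}_2}\frac{1}{D_C}\iint_{\Omega_C}g(t)\,dt\,d\theta,$$ with equality in $[0,\infty]$. The same identity holds for real- or complex-valued Borel $g$ whenever $g(F(U))$ is integrable, equivalently whenever the right-hand side with $|g|$ in place of $g$ is finite. In particular, for $r\ge0$ the choice $g(t)=|t|^r$ requires no lower support bound; and if $F\ge m>0$ for some constant $m$, then $g(t)=t^r$ is admissible for every real $r$.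
   Context: $S^2$ is the unit sphere of $\mathbb{R}^3$ and $\sigma$ its rotation-invariant probability measure. A two-dimensional spherical polyhedral cell is a subset of $S^2$ cut out by finitely many hemispherical inequalities $b_j\cdot u\ge0$ and having nonempty interior in $S^2$; $\operatorname{int}C$ is its interior in $S^2$. The angle $\theta$ ranges over one full period $[0,2\pi)$. *)

theory Defs
  imports "HOL-Probability.Probability"
begin

abbreviation S2 :: "(real^3) set" where
  "S2 \<equiv> sphere 0 1"

text \<open>A rotation-invariant Borel probability measure on the sphere. Rotations are the elements of
  SO(3), and measurability on the sphere is Borel measurability. There is exactly one such measure;
  only its existence is recorded here.\<close>

definition rotation_invariant_prob :: "(real^3) measure \<Rightarrow> bool" where
  "rotation_invariant_prob \<sigma> \<longleftrightarrow>
     prob_space \<sigma> \<and> sets \<sigma> = sets (restrict_space borel S2) \<and>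
     (\<forall>Q. rotation_matrix Q \<longrightarrow> distr \<sigma> \<sigma> (\<lambda>u. Q *v u) = \<sigma>)"

lemma rotation_invariant_prob_exists: "\<exists>\<sigma>. rotation_invariant_prob \<sigma>"
proof -
  define B :: "(real^3) set" where "B = cball 0 1 - {0}"
  define h :: "real^3 \<Rightarrow> real^3" where "h = (\<lambda>x. if x = 0 then axis 1 1 else x /\<^sub>R norm x)"
  define \<mu> where "\<mu> = uniform_measure lborel B"
  let ?R = "restrict_space borel S2"
  define \<sigma> where "\<sigma> = distr \<mu> ?R h"
  have B [measurable]: "B \<in> sets borel" by (simp add: B_def)
  have Bpos: "emeasure lborel B \<noteq> 0"
  proof
    assume "emeasure lborel B = 0"
    then have "B \<in> null_sets lborel" by (simp add: null_sets_def)
    moreover have "{0::real^3} \<in> null_sets lborel" by auto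
    ultimately have "B \<union> {0} \<in> null_sets lborel" by (rule null_sets.Un)
    moreover have "B \<union> {0} = cball 0 1" by (auto simp: B_def)
    ultimately have "emeasure lborel (cball (0::real^3) 1) = 0" by (simp add: null_sets_def)
    then show False using emeasure_cball[of 1 "0::real^3"] unit_ball_vol_pos[of 3] by simp
  qed
  have Bfin: "emeasure lborel B < \<infinity>"
    by (rule le_less_trans[OF emeasure_mono[of _ "cball 0 1"]]) (auto simp: B_def emeasure_cball)
  interpret \<mu>: prob_space \<mu>
    unfolding \<mu>_def using Bpos Bfin by (intro prob_space_uniform_measure) auto
  have hb: "h \<in> borel \<rightarrow>\<^sub>M borel" unfolding h_def by measurable
  have h [measurable]: "h \<in> \<mu> \<rightarrow>\<^sub>M ?R"
  proof -
    have "h \<in> \<mu> \<rightarrow>\<^sub>M borel" using hb by (simp add: \<mu>_def)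
    moreover have "h x \<in> S2" for x by (simp add: h_def)
    ultimately show ?thesis by (intro measurable_restrict_space2) auto
  qed
  have "distr \<sigma> \<sigma> (\<lambda>u. Q *v u) = \<sigma>" if Q: "rotation_matrix Q" for Q :: "real^3^3"
  proof (rule measure_eqI)
    have ot: "orthogonal_transformation (\<lambda>u. Q *v u)"
      using Q by (simp add: rotation_matrix_def orthogonal_transformation_matrix)
    then have nQ: "norm (Q *v u) = norm u" for u
      by (rule orthogonal_transformation_norm)
    have inj: "inj (\<lambda>u. Q *v u)" and surj: "surj (\<lambda>u. Q *v u)"
      using orthogonal_transformation_inj[OF ot] orthogonal_transformation_surj[OF ot] by blast+
    have bQ [measurable]: "(\<lambda>u. Q *v u) \<in> borel \<rightarrow>\<^sub>M borel"
      by (intro borel_measurable_continuous_onI continuous_intros)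
    have mQ: "(\<lambda>u. Q *v u) \<in> ?R \<rightarrow>\<^sub>M ?R"
      by (rule measurable_restrict_space3) (auto simp: nQ)
    have mQ': "(\<lambda>u. Q *v u) \<in> \<sigma> \<rightarrow>\<^sub>M \<sigma>" using mQ by (simp add: \<sigma>_def)
    show "sets (distr \<sigma> \<sigma> (\<lambda>u. Q *v u)) = sets \<sigma>" by simp
    fix A assume "A \<in> sets (distr \<sigma> \<sigma> (\<lambda>u. Q *v u))"
    then have A: "A \<in> sets ?R" by (simp add: \<sigma>_def)
    then have Ab [measurable]: "A \<in> sets borel" by (simp add: sets_restrict_space_iff)
    define T where "T = B \<inter> h -` A"
    define T' where "T' = B \<inter> (\<lambda>x. Q *v h x) -` A"
    have mT: "T \<in> sets borel" unfolding T_def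
      by (intro sets.Int B measurable_sets_borel[OF hb Ab])
    have mT': "T' \<in> sets borel" unfolding T'_def
      by (intro sets.Int B measurable_sets_borel[OF _ Ab] measurable_compose[OF hb bQ])
    have fin: "X \<in> lmeasurable" if "X \<in> sets borel" "X \<subseteq> B" for X
      using that by (intro bounded_set_imp_lmeasurable bounded_subset[of "cball 0 1" X])
         (auto simp: B_def)
    have L: "T \<in> lmeasurable" "T' \<in> lmeasurable"
      using fin[OF mT] fin[OF mT'] by (auto simp: T_def T'_def)
    have hQ: "h (Q *v x) = Q *v h x" if "x \<in> B" for x
    proof -
      have "x \<noteq> 0" "Q *v x \<noteq> 0" using that nQ[of x] by (auto simp: B_def)
      then show ?thesis by (simp add: h_def nQ matrix_vector_mult_scaleR)
    qed
    have BQ: "Q *v x \<in> B \<longleftrightarrow> x \<in> B" for x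
      using nQ[of x] by (auto simp: B_def)
    have img: "(\<lambda>u. Q *v u) ` T' = T"
    proof safe
      fix x assume "x \<in> T'"
      then show "Q *v x \<in> T" by (auto simp: T_def T'_def BQ hQ)
    next
      fix y assume y: "y \<in> T"
      obtain x where x: "y = Q *v x" using surj by auto
      then have "x \<in> T'" using y BQ[of x] hQ[of x] by (auto simp: T_def T'_def)
      then show "y \<in> (\<lambda>u. Q *v u) ` T'" using x by auto
    qed
    have "measure lebesgue T = measure lebesgue T'"
      using measure_orthogonal_image[OF ot L(2)] img by simp
    then have "emeasure lebesgue T = emeasure lebesgue T'"
      using L by (simp add: emeasure_eq_measure2 fmeasurableD2 emeasure_eq_ennreal_measure)
    then have TT: "emeasure lborel T = emeasure lborel T'"
      using mT mT' by simp
    have "emeasure (distr \<sigma> \<sigma> (\<lambda>u. Q *v u)) A = emeasure (distr \<mu> \<sigma> (\<lambda>x. Q *v h x)) A"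
      using mQ by (simp add: \<sigma>_def distr_distr comp_def)
    also have "\<dots> = emeasure \<mu> ((\<lambda>x. Q *v h x) -` A)"
      by (subst emeasure_distr)
         (use A mQ h in \<open>auto simp: \<sigma>_def \<mu>_def intro: measurable_compose\<close>)
    also have "\<dots> = emeasure lborel T' / emeasure lborel B"
      unfolding \<mu>_def T'_def
      by (rule emeasure_uniform_measure)
         (auto intro!: measurable_sets_borel[OF _ Ab] measurable_compose[OF hb bQ])
    also have "\<dots> = emeasure lborel T / emeasure lborel B" by (simp add: TT)
    also have "\<dots> = emeasure \<mu> (h -` A)"
      unfolding \<mu>_def T_def
      by (rule emeasure_uniform_measure[symmetric])
         (auto intro!: measurable_sets_borel[OF _ Ab] hb)
    also have "\<dots> = emeasure \<sigma> A"
      unfolding \<sigma>_def by (subst emeasure_distr) (use A h in \<open>auto simp: \<mu>_def\<close>)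
    finally show "emeasure (distr \<sigma> \<sigma> (\<lambda>u. Q *v u)) A = emeasure \<sigma> A" .
  qed
  moreover have "prob_space \<sigma>" unfolding \<sigma>_def by (rule \<mu>.prob_space_distr) (rule h)
  ultimately have "rotation_invariant_prob \<sigma>"
    by (simp add: rotation_invariant_prob_def) (simp add: \<sigma>_def)
  then show ?thesis ..
qed

abbreviation int_S2 :: "(real^3) set \<Rightarrow> (real^3) set" where
  "int_S2 C \<equiv> top_of_set S2 interior_of C"

definition spherical_cell :: "(real^3) set \<Rightarrow> bool" where
  "spherical_cell C \<longleftrightarrow>
     (\<exists>B. finite B \<and> C = {u \<in> S2. \<forall>b\<in>B. b \<bullet> u \<ge> 0}) \<and> int_S2 C \<noteq> {}"

definition orthonormal_basis3 :: "real^3 \<Rightarrow> real^3 \<Rightarrow> real^3 \<Rightarrow> bool" where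
  "orthonormal_basis3 v0 v1 v2 \<longleftrightarrow>
     norm v0 = 1 \<and> norm v1 = 1 \<and> norm v2 = 1 \<and>
     v0 \<bullet> v1 = 0 \<and> v0 \<bullet> v2 = 0 \<and> v1 \<bullet> v2 = 0 \<and>
     span {v0, v1, v2} = UNIV"

definition chart :: "real^3 \<Rightarrow> real^3 \<Rightarrow> real^3 \<Rightarrow> real \<Rightarrow> real \<Rightarrow> real^3" where
  "chart a e1 e2 t \<theta> =
     (t / norm a) *\<^sub>R (a /\<^sub>R norm a) +
     sqrt (1 - t\<^sup>2 / (norm a)\<^sup>2) *\<^sub>R (cos \<theta> *\<^sub>R e1 + sin \<theta> *\<^sub>R e2)"

definition chart_domain :: "real^3 \<Rightarrow> real^3 \<Rightarrow> real^3 \<Rightarrow> (real^3) set \<Rightarrow> (real \<times> real) set" where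
  "chart_domain a e1 e2 C =
     {(t, \<theta>). \<bar>t\<bar> < norm a \<and> 0 \<le> \<theta> \<and> \<theta> < 2 * pi \<and> chart a e1 e2 t \<theta> \<in> int_S2 C}"

text \<open>The right-hand side of the formula: once as an element of \<open>[0, \<infinity>]\<close>, and once as a
  Lebesgue integral. The latter is meaningful only together with the integrability of the integrand
  over every domain, which is stated separately since non-integrable functions have integral 0.\<close>

definition rhs_nn :: "(real^3) set set \<Rightarrow> ((real^3) set \<Rightarrow> real^3) \<Rightarrow> ((real^3) set \<Rightarrow> real^3) \<Rightarrow>
    ((real^3) set \<Rightarrow> real^3) \<Rightarrow> (real \<Rightarrow> ennreal) \<Rightarrow> ennreal" where
  "rhs_nn \<C> a e1 e2 g =
     ennreal (1 / (4 * pi)) * (\<Sum>C\<in>\<C>. ennreal (1 / norm (a C)) *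
       (\<integral>\<^sup>+z\<in>chart_domain (a C) (e1 C) (e2 C) C. g (fst z) \<partial>lborel))"

definition rhs_integrable :: "(real^3) set set \<Rightarrow> ((real^3) set \<Rightarrow> real^3) \<Rightarrow>
    ((real^3) set \<Rightarrow> real^3) \<Rightarrow> ((real^3) set \<Rightarrow> real^3) \<Rightarrow>
    (real \<Rightarrow> 'b::{banach, second_countable_topology}) \<Rightarrow> bool" where
  "rhs_integrable \<C> a e1 e2 g \<longleftrightarrow>
     (\<forall>C\<in>\<C>. set_integrable lborel (chart_domain (a C) (e1 C) (e2 C) C) (\<lambda>z. g (fst z)))"

definition rhs :: "(real^3) set set \<Rightarrow> ((real^3) set \<Rightarrow> real^3) \<Rightarrow> ((real^3) set \<Rightarrow> real^3) \<Rightarrow>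
    ((real^3) set \<Rightarrow> real^3) \<Rightarrow> (real \<Rightarrow> 'b::{banach, second_countable_topology}) \<Rightarrow> 'b" where
  "rhs \<C> a e1 e2 g =
     (1 / (4 * pi)) *\<^sub>R (\<Sum>C\<in>\<C>. (1 / norm (a C)) *\<^sub>R
       (\<integral>z\<in>chart_domain (a C) (e1 C) (e2 C) C. g (fst z) \<partial>lborel))"

text \<open>\<open>\<bar>t\<bar>\<close> to the power \<open>r \<ge> 0\<close> with the convention that \<open>0\<close> to the power \<open>0\<close> is \<open>1\<close>; in
  the library, \<open>0 powr 0 = 0\<close>.\<close>

definition abs_pow :: "real \<Rightarrow> real \<Rightarrow> real" where
  "abs_pow r t = (if r = 0 then 1 else \<bar>t\<bar> powr r)"

end

theory Submission
  imports Defs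
begin

text \<open>On a cell, \<open>F\<close> is \<open>a \<bullet> u\<close>, which is the coordinate \<open>t\<close> of the chart, so the formula is
  Archimedes' hat-box theorem: the chart carries the uniform measure of a rectangle to \<open>\<sigma>\<close>.
  A Borel probability measure on a compact set is determined by the fact that its balls of equal
  radius have equal mass (Christensen), so it suffices to check this for both measures. For \<open>\<sigma>\<close> it is
  rotation invariance. For the image of the rectangle, the map \<open>(\<rho>, t, \<theta>) \<mapsto> \<rho> u(t, \<theta>)\<close> has
  Jacobian \<open>\<rho>\<^sup>2 / D\<close>, so the mass of a set is proportional to the volume of the cone over it.\<close>

section \<open>Uniformly distributed measures\<close>

text \<open>\<open>\<sigma>\<close> is known only through its invariance, so its values on
  coordinate patches cannot be computed directly; that balls of equal radius have equal mass can be
  checked for both measures without a common formula. The volume of a cone is the intermediary on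
  the chart side: it does not depend on the frame, whereas the rectangle does, and Lebesgue measure
  is invariant under orthogonal maps. The radial variable makes the parametrisation a map between
  spaces of equal dimension. Neither t nor \<theta> appears in the Jacobian, because the shrinking
  of the latitude circles is compensated by the stretching of the height. This leaves the factor 1/D
  of the formula, and the 4 * pi comes from the area 4 * pi * D of the rectangle. The chart misses
  the two poles on the axis of a, that is, a negligible line in the picture of cones. Piecewise
  linearity enters afterwards, one cell at a time, each with the frame adapted to its own
  vector.\<close>

lemma nn_integral_emeasure_ball:
  fixes M N :: "('a::{metric_space, second_countable_topology}) measure"
  assumes "sigma_finite_measure M" "sigma_finite_measure N"
    and [measurable_cong]: "sets M = sets borel" "sets N = sets borel"
    and A [measurable]: "A \<in> sets borel" and B [measurable]: "B \<in> sets borel"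
  shows "(\<integral>\<^sup>+u\<in>A. emeasure N (B \<inter> ball u r) \<partial>M) = (\<integral>\<^sup>+v\<in>B. emeasure M (A \<inter> ball v r) \<partial>N)"
proof -
  interpret pair_sigma_finite M N
    using assms(1,2) by (simp add: pair_sigma_finite_def)
  have "open {z::'a\<times>'a. dist (fst z) (snd z) < r}"
    by (intro open_Collect_less continuous_intros)
  then have [measurable]: "{z::'a\<times>'a. dist (fst z) (snd z) < r} \<in> sets (borel \<Otimes>\<^sub>M borel)"
    by (subst borel_prod) (rule borel_open)
  \<comment> \<open>Both sides are the product measure of the pairs in \<open>A\<close> times
    \<open>B\<close> at distance less than r, sliced in the two orders; by symmetry of the distance
    the slices are balls either way.\<close>
  define f :: "'a \<Rightarrow> 'a \<Rightarrow> ennreal" where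
    "f u v = indicator A u * indicator B v * indicator {z. dist (fst z) (snd z) < r} (u, v)" for u v
  have f [measurable]: "case_prod f \<in> borel_measurable (M \<Otimes>\<^sub>M N)"
    unfolding f_def by measurable
  have "(\<integral>\<^sup>+u\<in>A. emeasure N (B \<inter> ball u r) \<partial>M) = (\<integral>\<^sup>+u. \<integral>\<^sup>+v. f u v \<partial>N \<partial>M)"
  proof (rule nn_integral_cong)
    fix u
    have "(\<integral>\<^sup>+v. f u v \<partial>N) = (\<integral>\<^sup>+v. indicator A u * indicator (B \<inter> ball u r) v \<partial>N)"
      by (rule nn_integral_cong) (simp add: f_def indicator_def)
    then show "emeasure N (B \<inter> ball u r) * indicator A u = (\<integral>\<^sup>+v. f u v \<partial>N)"
      by (subst (asm) nn_integral_cmult_indicator) (simp_all add: mult.commute)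
  qed
  also have "\<dots> = (\<integral>\<^sup>+v. \<integral>\<^sup>+u. f u v \<partial>M \<partial>N)"
    by (rule Fubini'[symmetric]) (rule f)
  also have "\<dots> = (\<integral>\<^sup>+v\<in>B. emeasure M (A \<inter> ball v r) \<partial>N)"
  proof (rule nn_integral_cong)
    fix v
    have "(\<integral>\<^sup>+u. f u v \<partial>M) = (\<integral>\<^sup>+u. indicator B v * indicator (A \<inter> ball v r) u \<partial>M)"
      by (rule nn_integral_cong) (simp add: f_def indicator_def dist_commute)
    then show "(\<integral>\<^sup>+u. f u v \<partial>M) = emeasure M (A \<inter> ball v r) * indicator B v"
      by (subst (asm) nn_integral_cmult_indicator) (simp_all add: mult.commute)
  qed
  finally show ?thesis .
qed

text \<open>The previous lemma for \<open>A\<close> and an open neighbourhood of \<open>A\<close> that contains all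
  \<open>r\<close>-balls centred in \<open>A\<close>, as \<open>r \<rightarrow> 0\<close>.\<close>

lemma uniformly_distributed_measure_le:
  fixes M N :: "('a::{metric_space, second_countable_topology}) measure"
  assumes "prob_space M" "prob_space N"
    and sM: "sets M = sets borel" and sN: "sets N = sets borel"
    and AM: "AE u in M. u \<in> S" and AN: "AE u in N. u \<in> S"
    and cM: "\<And>r u. u \<in> S \<Longrightarrow> emeasure M (ball u r) = c r"
    and cN: "\<And>r u. u \<in> S \<Longrightarrow> emeasure N (ball u r) = d r"
    and pos: "\<And>r. r > 0 \<Longrightarrow> c r \<noteq> 0"
    and A: "closed A"
  shows "emeasure M A \<le> emeasure N A"
proof (cases "A = {}")
  case False
  interpret M: prob_space M by fact
  interpret N: prob_space N by fact
  note [measurable_cong] = sM sN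
  have spM: "space M = UNIV" and spN: "space N = UNIV"
    using sets_eq_imp_space_eq[OF sM] sets_eq_imp_space_eq[OF sN] by simp_all
  note ball_swap = nn_integral_emeasure_ball[OF M.sigma_finite_measure N.sigma_finite_measure sM sN]
  have [measurable]: "A \<in> sets borel" using A by simp
  \<comment> \<open>With the whole space for both sets, the swap equates the averages of the two
    constant ball masses.\<close>
  have cd: "c r = d r" for r
  proof -
    have "d r = (\<integral>\<^sup>+u. d r \<partial>M)" using M.emeasure_space_1 by (simp add: spM)
    also have "\<dots> = (\<integral>\<^sup>+u. emeasure N (ball u r) \<partial>M)"
      using AM by (intro nn_integral_cong_AE) (auto simp: cN)
    also have "\<dots> = (\<integral>\<^sup>+u. emeasure M (ball u r) \<partial>N)"
      using ball_swap[of UNIV UNIV r] by simp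
    also have "\<dots> = (\<integral>\<^sup>+u. c r \<partial>N)"
      using AN by (intro nn_integral_cong_AE) (auto simp: cM)
    also have "\<dots> = c r" using N.emeasure_space_1 by (simp add: spN)
    finally show ?thesis by simp
  qed
  have S: "S \<noteq> {}" using AM M.emeasure_space_1 by (auto simp: M.AE_False)
  define V where "V n = {v. infdist v A < 1 / real (Suc n)}" for n
  have V [measurable]: "V n \<in> sets borel" for n
    unfolding V_def by (intro borel_open open_Collect_less continuous_intros)
  have le: "emeasure M A \<le> emeasure N (V n)" for n
  proof -
    \<comment> \<open>The radius of the balls equals the width of \<open>V n\<close>: a ball centred
      in \<open>A\<close> then lies inside \<open>V n\<close>, and its full mass \<open>c r\<close>
      appears on the left.\<close>
    define r where "r = 1 / real (Suc n)"
    have r: "r > 0" by (simp add: r_def)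
    obtain s where s: "s \<in> S" using S by auto
    \<comment> \<open>The factor \<open>c r\<close> ends up on both sides, and in
      \<open>ennreal\<close> it cancels only if it is nonzero and finite.\<close>
    have c: "c r \<noteq> 0" "c r \<noteq> \<infinity>" using pos[OF r] cM[OF s, of r] M.emeasure_finite by auto
    have "c r * emeasure M A = (\<integral>\<^sup>+u. c r * indicator A u \<partial>M)"
      by (simp add: nn_integral_cmult)
    also have "\<dots> = (\<integral>\<^sup>+u\<in>A. emeasure N (V n \<inter> ball u r) \<partial>M)"
    proof (rule nn_integral_cong_AE, use AM in eventually_elim)
      fix u assume u: "u \<in> S"
      have "ball u r \<subseteq> V n" if "u \<in> A"
      proof
        fix v assume "v \<in> ball u r"
        then have "infdist v A < r"
          using infdist_le[OF that, of v] by (simp add: dist_commute)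
        then show "v \<in> V n" by (simp add: V_def r_def)
      qed
      then show "c r * indicator A u = emeasure N (V n \<inter> ball u r) * indicator A u"
        by (auto simp: cd cN u Int_absorb1 split: split_indicator)
    qed
    also have "\<dots> = (\<integral>\<^sup>+v\<in>V n. emeasure M (A \<inter> ball v r) \<partial>N)"
      by (rule ball_swap) auto
    also have "\<dots> \<le> (\<integral>\<^sup>+v\<in>V n. c r \<partial>N)"
    proof (rule nn_integral_mono_AE, use AN in eventually_elim)
      fix v assume "v \<in> S"
      then have "emeasure M (A \<inter> ball v r) \<le> c r"
        using emeasure_mono[of "A \<inter> ball v r" "ball v r" M] by (simp add: cM sM)
      then show "emeasure M (A \<inter> ball v r) * indicator (V n) v \<le> c r * indicator (V n) v"
        by (intro mult_right_mono) auto
    qed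
    also have "\<dots> = c r * emeasure N (V n)" by (simp add: nn_integral_cmult)
    finally show ?thesis
      using c by (subst (asm) ennreal_mult_le_mult_iff) auto
  qed
  have "(\<lambda>n. emeasure N (V n)) \<longlonglongrightarrow> emeasure N (\<Inter>n. V n)"
  proof (rule Lim_emeasure_decseq)
    show "decseq V"
    proof (rule decseq_SucI)
      show "V (Suc n) \<subseteq> V n" for n
      proof
        fix v assume "v \<in> V (Suc n)"
        then have "infdist v A < 1 / real (Suc (Suc n))" by (simp add: V_def)
        also have "\<dots> \<le> 1 / real (Suc n)" by (intro divide_left_mono) auto
        finally show "v \<in> V n" by (simp add: V_def)
      qed
    qed
  qed (simp_all add: sN image_subset_iff)
  \<comment> \<open>Here closedness enters: distance zero from \<open>A\<close> means membership in
    \<open>A\<close>.\<close>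
  moreover have "(\<Inter>n. V n) = A"
  proof
    show "A \<subseteq> (\<Inter>n. V n)" by (auto simp: V_def)
    show "(\<Inter>n. V n) \<subseteq> A"
    proof
      fix v assume v: "v \<in> (\<Inter>n. V n)"
      have "infdist v A \<le> 0"
      proof (rule field_le_epsilon)
        fix e :: real assume "e > 0"
        then obtain n where "1 / real (Suc n) < e" using nat_approx_posE by blast
        then show "infdist v A \<le> 0 + e" using v by (auto simp: V_def dest: spec[of _ n])
      qed
      then show "v \<in> A"
        using in_closed_iff_infdist_zero[OF A False] infdist_nonneg[of v A] by simp
    qed
  qed
  ultimately show ?thesis
    using le by (intro LIMSEQ_le_const[where X = "\<lambda>n. emeasure N (V n)"]) auto
qed simp

text \<open>Compactness supplies positivity: finitely many balls of a given radius cover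
  \<open>S\<close> and have equal mass, so if they were null, \<open>S\<close> would be null. Two
  inequalities give equality on closed sets, an intersection-stable generator of the Borel
  sets.\<close>

lemma uniformly_distributed_measure_unique:
  fixes M N :: "('a::{metric_space, second_countable_topology}) measure"
  assumes M: "prob_space M" and N: "prob_space N"
    and sM: "sets M = sets borel" and sN: "sets N = sets borel"
    and AM: "AE u in M. u \<in> S" and AN: "AE u in N. u \<in> S"
    and S: "compact S"
    and cM: "\<And>r u v. u \<in> S \<Longrightarrow> v \<in> S \<Longrightarrow> emeasure M (ball u r) = emeasure M (ball v r)"
    and cN: "\<And>r u v. u \<in> S \<Longrightarrow> v \<in> S \<Longrightarrow> emeasure N (ball u r) = emeasure N (ball v r)"
  shows "M = N"
proof -
  have pos: "emeasure L (ball s r) \<noteq> 0"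
    if L: "prob_space L" "sets L = sets borel" "AE u in L. u \<in> S" and s: "s \<in> S" and r: "r > 0"
      and cL: "\<And>r u v. u \<in> S \<Longrightarrow> v \<in> S \<Longrightarrow> emeasure L (ball u r) = emeasure L (ball v r)"
    for L :: "'a measure" and s r
  proof
    assume 0: "emeasure L (ball s r) = 0"
    interpret prob_space L by fact
    obtain k where k: "finite k" "k \<subseteq> S" "S \<subseteq> (\<Union>x\<in>k. ball x r)"
      using compactE_image[OF S, of S "\<lambda>x. ball x r"] r
      by (metis UN_I centre_in_ball open_ball subsetI)
    have "emeasure L (ball u r) = 0" if "u \<in> k" for u
      using cL[of u s r] that k s 0 by auto
    then have "(\<Union>x\<in>k. ball x r) \<in> null_sets L"
      using k(1) L(2) by (intro null_sets_UN') (auto simp: countable_finite)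
    then have "AE x in L. x \<notin> (\<Union>x\<in>k. ball x r)" by (rule AE_not_in)
    then have "AE x in L. False" using L(3) by eventually_elim (use k(3) in auto)
    then show False by (simp add: AE_False)
  qed
  interpret M: prob_space M by fact
  have "S \<noteq> {}" using AM by (auto simp: M.AE_False)
  then obtain s where s: "s \<in> S" by auto
  have eq: "emeasure M A = emeasure N A" if "closed A" for A
  proof (rule antisym)
    show "emeasure M A \<le> emeasure N A"
      using s pos[OF M sM AM s _ cM]
      by (intro uniformly_distributed_measure_le[OF M N sM sN AM AN cM[OF _ s] cN[OF _ s] _ that]) auto
    show "emeasure N A \<le> emeasure M A"
      using s pos[OF N sN AN s _ cN]
      by (intro uniformly_distributed_measure_le[OF N M sN sM AN AM cN[OF _ s] cM[OF _ s] _ that]) auto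
  qed
  show ?thesis
  proof (rule measure_eqI_generator_eq[where E = "Collect closed" and \<Omega> = UNIV and A = "\<lambda>_. UNIV"])
    show "Int_stable (Collect closed)" by (auto simp: Int_stable_def)
    show "sets M = sigma_sets UNIV (Collect closed)" "sets N = sigma_sets UNIV (Collect closed)"
      by (simp_all add: sM sN borel_eq_closed)
    show "emeasure M UNIV \<noteq> \<infinity>" by simp
  qed (use eq in auto)
qed

section \<open>The volume of a cone over a spherical set\<close>

text \<open>Volumes of cones live in \<open>real^3\<close>, iterated integrals on products. The two
  Lebesgue measures are identified by their values on boxes.\<close>

lemma lborel_vec3:
  "distr lborel borel (\<lambda>(x, y, z). x *\<^sub>R axis 1 1 + y *\<^sub>R axis 2 1 + z *\<^sub>R axis 3 1) = (lborel :: (real^3) measure)"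
    (is "distr lborel borel ?f = _")
proof (rule lborel_eqI[symmetric])
  have f: "?f = (\<lambda>p. fst p *\<^sub>R axis 1 1 + fst (snd p) *\<^sub>R axis 2 1 + snd (snd p) *\<^sub>R axis 3 1)"
    by (simp add: fun_eq_iff split_beta)
  have [measurable]: "?f \<in> borel_measurable borel"
    unfolding f by (intro borel_measurable_continuous_onI continuous_intros)
  fix l u :: "real^3"
  assume le: "\<And>b. b \<in> Basis \<Longrightarrow> l \<bullet> b \<le> u \<bullet> b"
  have le': "l$i \<le> u$i" for i
    using le[of "axis i 1"] by (simp add: inner_axis axis_in_Basis_iff)
  have "?f -` box l u = box (l$1, l$2, l$3) (u$1, u$2, u$3)"
    by (auto simp: mem_box_cart forall_3 axis_def) (auto simp: mem_box Basis_prod_def ball_Un)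
  then have "emeasure (distr lborel borel ?f) (box l u) = emeasure lborel (box (l$1, l$2, l$3) (u$1, u$2, u$3))"
    by (subst emeasure_distr) auto
  also have "\<dots> = (\<Prod>b\<in>Basis. ((u$1, u$2, u$3) - (l$1, l$2, l$3)) \<bullet> b)"
    using le' by (intro emeasure_lborel_box) (auto simp: Basis_prod_def)
  also have "(\<Prod>b\<in>Basis. ((u$1, u$2, u$3) - (l$1, l$2, l$3)) \<bullet> b) = (u$1 - l$1) * (u$2 - l$2) * (u$3 - l$3)"
    by (simp add: Basis_prod_def prod.union_disjoint prod.reindex inj_on_def)
  also have "(u$1 - l$1) * (u$2 - l$2) * (u$3 - l$3) = (\<Prod>b\<in>Basis. (u - l) \<bullet> b)"
  proof -
    have B: "Basis = {axis 1 1, axis 2 1, axis 3 1 :: real^3}" by (auto simp: Basis_vec_def UNIV_3)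
    show ?thesis unfolding B by (simp add: axis_eq_axis inner_axis)
  qed
  finally show "emeasure (distr lborel borel ?f) (box l u) = (\<Prod>b\<in>Basis. (u - l) \<bullet> b)" .
qed simp

lemma nn_integral_lborel_vec3:
  fixes f :: "real \<Rightarrow> ennreal" and h :: "real \<times> real \<Rightarrow> ennreal"
  assumes [measurable]: "f \<in> borel_measurable borel" "h \<in> borel_measurable borel"
  shows "(\<integral>\<^sup>+(x::real^3). f (x$1) * h (x$2, x$3) \<partial>lborel) = (\<integral>\<^sup>+r. f r \<partial>lborel) * (\<integral>\<^sup>+z. h z \<partial>lborel)"
proof -
  have [measurable]: "(\<lambda>x::real^3. x$i) \<in> borel_measurable borel" for i
    by (intro borel_measurable_continuous_onI continuous_intros)
  let ?f = "\<lambda>(x, y, z). x *\<^sub>R axis 1 1 + y *\<^sub>R axis 2 1 + z *\<^sub>R axis 3 1 :: real^3"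
  have "?f = (\<lambda>p. fst p *\<^sub>R axis 1 1 + fst (snd p) *\<^sub>R axis 2 1 + snd (snd p) *\<^sub>R axis 3 1)"
    by (simp add: fun_eq_iff split_beta)
  then have [measurable]: "?f \<in> borel_measurable borel"
    by (simp only:) (intro borel_measurable_continuous_onI continuous_intros)
  have comp: "?f p $ 1 = fst p" "(?f p $ 2, ?f p $ 3) = snd p" for p
    by (auto simp: axis_def split: prod.split)
  have "(\<integral>\<^sup>+(x::real^3). f (x$1) * h (x$2, x$3) \<partial>lborel) = (\<integral>\<^sup>+p. f (fst p) * h (snd p) \<partial>lborel)"
    by (subst lborel_vec3[symmetric], subst nn_integral_distr) (simp_all add: comp)
  also have "\<dots> = (\<integral>\<^sup>+p. f (fst p) * h (snd p) \<partial>(lborel \<Otimes>\<^sub>M lborel))"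
    by (simp add: lborel_prod)
  also have "\<dots> = (\<integral>\<^sup>+r. \<integral>\<^sup>+z. f r * h z \<partial>lborel \<partial>lborel)"
    by (subst lborel.nn_integral_fst[symmetric]) auto
  also have "\<dots> = (\<integral>\<^sup>+r. f r \<partial>lborel) * (\<integral>\<^sup>+z. h z \<partial>lborel)"
    by (simp add: nn_integral_cmult nn_integral_multc)
  finally show ?thesis .
qed

text \<open>The half-open period makes the chart injective on the box while it still reaches every
  unit vector off the axis.\<close>

definition chart_box :: "real^3 \<Rightarrow> (real \<times> real) set" where
  "chart_box a = {- norm a<..<norm a} \<times> {0..<2 * pi}"

lemma chart_box_iff: "(t, \<theta>) \<in> chart_box a \<longleftrightarrow> \<bar>t\<bar> < norm a \<and> 0 \<le> \<theta> \<and> \<theta> < 2 * pi"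
  by (auto simp: chart_box_def)

lemma chart_box_borel [measurable]: "chart_box a \<in> sets borel"
  unfolding chart_box_def by (subst borel_prod[symmetric]) auto

lemma emeasure_chart_box: "emeasure lborel (chart_box a) = ennreal (4 * pi * norm a)"
proof -
  have "emeasure lborel (chart_box a) = emeasure (lborel \<Otimes>\<^sub>M lborel) (chart_box a)"
    by (simp add: lborel_prod)
  also have "\<dots> = ennreal (2 * norm a) * ennreal (2 * pi)"
    unfolding chart_box_def by (subst lborel.emeasure_pair_measure_Times) auto
  also have "\<dots> = ennreal (4 * pi * norm a)"
    by (simp add: ennreal_mult[symmetric] mult_ac)
  finally show ?thesis .
qed

text \<open>The chart is continuous on the whole plane, also off the box, because
  \<open>sqrt\<close> is continuous on all reals. Writing the division as multiplication by a
  constant avoids a condition on \<open>a\<close>.\<close>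

lemma chart_borel [measurable]: "(\<lambda>z. chart a e1 e2 (fst z) (snd z)) \<in> borel_measurable borel"
  unfolding chart_def divide_inverse by (intro borel_measurable_continuous_onI continuous_intros)

text \<open>Only \<open>A \<inter> S2\<close> matters, so balls of \<open>real^3\<close> can be
  inserted directly. The apex has no direction and is left out.\<close>

definition solid_cone :: "(real^3) set \<Rightarrow> (real^3) set" where
  "solid_cone A = {x. x \<noteq> 0 \<and> norm x \<le> 1 \<and> x /\<^sub>R norm x \<in> A}"

lemma solid_cone_borel [measurable]:
  assumes "A \<in> sets borel"
  shows "solid_cone A \<in> sets borel"
proof -
  have "(\<lambda>x::real^3. x /\<^sub>R norm x) \<in> borel_measurable borel" by measurable
  from measurable_sets_borel[OF this assms] show ?thesis
    by (simp add: solid_cone_def Collect_conj_eq vimage_def)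
qed

lemma bounded_solid_cone: "bounded (solid_cone A)"
  by (rule boundedI[of _ 1]) (simp add: solid_cone_def)

section \<open>Geometry of the chart of a single cell\<close>

locale frame =
  fixes a e1 e2 :: "real^3"
  assumes a_nz: "a \<noteq> 0" and basis: "orthonormal_basis3 (a /\<^sub>R norm a) e1 e2"
begin

definition u0 where "u0 = a /\<^sub>R norm a"
definition s where "s t = sqrt (1 - t\<^sup>2 / (norm a)\<^sup>2)"
abbreviation "u \<equiv> chart a e1 e2"

lemma norm_a: "norm a > 0"
  using a_nz by simp

lemma orthonormal:
  "u0 \<bullet> u0 = 1" "e1 \<bullet> e1 = 1" "e2 \<bullet> e2 = 1"
  "u0 \<bullet> e1 = 0" "u0 \<bullet> e2 = 0" "e1 \<bullet> e2 = 0" "e1 \<bullet> u0 = 0" "e2 \<bullet> u0 = 0" "e2 \<bullet> e1 = 0"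
proof -
  have *: "norm u0 = 1" "norm e1 = 1" "norm e2 = 1" "u0 \<bullet> e1 = 0" "u0 \<bullet> e2 = 0" "e1 \<bullet> e2 = 0"
    using basis by (simp_all only: orthonormal_basis3_def u0_def)
  then show "u0 \<bullet> u0 = 1" "e1 \<bullet> e1 = 1" "e2 \<bullet> e2 = 1" "u0 \<bullet> e1 = 0" "u0 \<bullet> e2 = 0" "e1 \<bullet> e2 = 0"
    by (simp_all only: norm_eq_1)
  then show "e1 \<bullet> u0 = 0" "e2 \<bullet> u0 = 0" "e2 \<bullet> e1 = 0"
    by (simp_all only: inner_commute)
qed

lemma a_u0: "a = norm a *\<^sub>R u0"
  using norm_a by (simp add: u0_def)

lemma chart_u0: "u t \<theta> = (t / norm a) *\<^sub>R u0 + (s t * cos \<theta>) *\<^sub>R e1 + (s t * sin \<theta>) *\<^sub>R e2"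
  by (simp add: chart_def u0_def s_def scaleR_add_right)

text \<open>The difference of the two sides is orthogonal to each frame vector, hence to their span,
  hence to itself.\<close>

lemma expand: "x = (u0 \<bullet> x) *\<^sub>R u0 + (e1 \<bullet> x) *\<^sub>R e1 + (e2 \<bullet> x) *\<^sub>R e2"
proof -
  define w where "w = x - ((u0 \<bullet> x) *\<^sub>R u0 + (e1 \<bullet> x) *\<^sub>R e1 + (e2 \<bullet> x) *\<^sub>R e2)"
  have "orthogonal w y" if "y \<in> span {u0, e1, e2}" for y
  proof (rule orthogonal_to_span[OF that])
    fix y assume "y \<in> {u0, e1, e2}"
    then show "orthogonal w y"
      using orthonormal by (auto simp: orthogonal_def w_def inner_diff_left inner_add_left inner_diff_right inner_add_right inner_commute)
  qed
  moreover have "span {u0, e1, e2} = UNIV" using basis by (simp only: orthonormal_basis3_def u0_def)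
  ultimately have "orthogonal w w" by blast
  then show ?thesis by (simp add: orthogonal_self w_def)
qed

lemma u0_chart: "u0 \<bullet> u t \<theta> = t / norm a"
  using orthonormal by (simp add: chart_u0 inner_add_right)

lemma a_chart: "a \<bullet> u t \<theta> = t"
  using norm_a by (subst a_u0) (simp add: u0_chart)

lemma e1_chart: "e1 \<bullet> u t \<theta> = s t * cos \<theta>"
  using orthonormal by (simp add: chart_u0 inner_add_right)

lemma e2_chart: "e2 \<bullet> u t \<theta> = s t * sin \<theta>"
  using orthonormal by (simp add: chart_u0 inner_add_right)

lemma s_arg_pos:
  assumes "\<bar>t\<bar> < norm a"
  shows "1 - t\<^sup>2 / (norm a)\<^sup>2 > 0"
proof -
  have "t\<^sup>2 < (norm a)\<^sup>2" using assms by (metis abs_norm_cancel abs_le_square_iff not_le)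
  then show ?thesis using norm_a by (simp add: divide_less_eq)
qed

lemma s_pos: "\<bar>t\<bar> < norm a \<Longrightarrow> s t > 0"
  using s_arg_pos[of t] by (simp add: s_def del: less_divide_eq_1 divide_less_eq_1)

lemma s_sq: "\<bar>t\<bar> < norm a \<Longrightarrow> (s t)\<^sup>2 = 1 - t\<^sup>2 / (norm a)\<^sup>2"
  using s_arg_pos[of t] unfolding s_def by (simp only: real_sqrt_pow2 less_imp_le)

lemma norm_sq_expand: "(norm x)\<^sup>2 = (u0 \<bullet> x)\<^sup>2 + (e1 \<bullet> x)\<^sup>2 + (e2 \<bullet> x)\<^sup>2"
proof -
  have "(norm x)\<^sup>2 = x \<bullet> ((u0 \<bullet> x) *\<^sub>R u0 + (e1 \<bullet> x) *\<^sub>R e1 + (e2 \<bullet> x) *\<^sub>R e2)"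
    using expand[of x] by (simp only: power2_norm_eq_inner)
  then show ?thesis
    by (simp only: inner_add_right inner_scaleR_right inner_commute[of x] power2_eq_square)
qed

lemma norm_chart:
  assumes "\<bar>t\<bar> < norm a"
  shows "norm (u t \<theta>) = 1"
proof -
  have "(norm (u t \<theta>))\<^sup>2 = t\<^sup>2 / (norm a)\<^sup>2 + (s t)\<^sup>2 * ((cos \<theta>)\<^sup>2 + (sin \<theta>)\<^sup>2)"
    using norm_sq_expand[of "u t \<theta>"]
    by (simp only: u0_chart e1_chart e2_chart power_mult_distrib power_divide distrib_left)
  then have "(norm (u t \<theta>))\<^sup>2 = 1" using s_sq[OF assms] by simp
  then show ?thesis by (simp add: power2_eq_1_iff) (smt (verit) norm_ge_zero)
qed

lemma chart_inj:
  assumes "(t, \<theta>) \<in> chart_box a" "(t', \<theta>') \<in> chart_box a" "u t \<theta> = u t' \<theta>'"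
  shows "t = t' \<and> \<theta> = \<theta>'"
proof
  show t: "t = t'" using assms(3) a_chart by metis
  have "s t > 0" using assms(1) s_pos by (simp add: chart_box_iff)
  then have "cos \<theta> = cos \<theta>'" "sin \<theta> = sin \<theta>'"
    using assms(3) e1_chart[of t \<theta>] e1_chart[of t' \<theta>'] e2_chart[of t \<theta>] e2_chart[of t' \<theta>'] t by auto
  then obtain n :: int where n: "\<theta> = \<theta>' + 2 * pi * n" using sin_cos_eq_iff by blast
  have "\<bar>2 * pi * n\<bar> < 2 * pi * 1" using assms(1,2) n by (auto simp: chart_box_iff)
  then have "\<bar>real_of_int n\<bar> < 1" by (simp add: abs_mult)
  then have "n = 0" by linarith
  then show "\<theta> = \<theta>'" using n by simp
qed

text \<open>Off the axis, \<open>x\<close> has a nonzero component orthogonal to \<open>a\<close>,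
  so the radius \<open>s t\<close> of its latitude circle is positive. Dividing that component by it
  leaves a point of the unit circle, which has an angle.\<close>

lemma chart_surj:
  assumes x: "norm x = 1" and nl: "x \<notin> span {a}"
  obtains t \<theta> where "(t, \<theta>) \<in> chart_box a" "u t \<theta> = x"
proof -
  define t where "t = a \<bullet> x"
  have u0x: "u0 \<bullet> x = t / norm a" by (simp add: t_def u0_def divide_inverse_commute)
  have eq: "(e1 \<bullet> x)\<^sup>2 + (e2 \<bullet> x)\<^sup>2 = 1 - t\<^sup>2 / (norm a)\<^sup>2"
    using norm_sq_expand[of x] x unfolding u0x by (simp add: power_divide)
  have pos: "1 - t\<^sup>2 / (norm a)\<^sup>2 > 0"
  proof (rule ccontr)
    assume "\<not> 1 - t\<^sup>2 / (norm a)\<^sup>2 > 0"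
    then have "(e1 \<bullet> x)\<^sup>2 + (e2 \<bullet> x)\<^sup>2 \<le> 0" using eq by simp
    then have "e1 \<bullet> x = 0" "e2 \<bullet> x = 0" by (simp_all add: sum_power2_le_zero_iff)
    then have "x = (u0 \<bullet> x) *\<^sub>R u0" using expand[of x] by simp
    then have "x \<in> span {a}" by (metis u0_def span_base span_scale singletonI)
    then show False using nl by simp
  qed
  then have "t\<^sup>2 < (norm a)\<^sup>2" using norm_a by (simp add: divide_less_eq_1)
  then have t: "\<bar>t\<bar> < norm a" by (metis abs_norm_cancel abs_le_square_iff not_le)
  have st: "s t > 0" by (rule s_pos) (rule t)
  have "((e1 \<bullet> x) / s t)\<^sup>2 + ((e2 \<bullet> x) / s t)\<^sup>2 = 1"
    using st by (simp add: power_divide add_divide_distrib[symmetric] eq[folded s_sq[OF t]])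
  then obtain \<theta> where \<theta>: "0 \<le> \<theta>" "\<theta> < 2 * pi" "(e1 \<bullet> x) / s t = cos \<theta>" "(e2 \<bullet> x) / s t = sin \<theta>"
    by (rule sincos_total_2pi)
  then have e: "e1 \<bullet> x = s t * cos \<theta>" "e2 \<bullet> x = s t * sin \<theta>" using st by (simp_all add: field_simps)
  have "u t \<theta> = x"
    by (subst expand[of x], subst u0x, subst e, subst e)
       (rule chart_u0)
  with t \<theta> show ?thesis by (intro that[of t \<theta>]) (auto simp: chart_box_iff)
qed

section \<open>The polar map and its Jacobian\<close>

definition polar :: "real^3 \<Rightarrow> real^3" where "polar x = (x$1) *\<^sub>R u (x$2) (x$3)"

text \<open>The columns are the frame vectors. The matrix is orthogonal, so the Jacobian can be
  computed in frame coordinates without changing its absolute value.\<close>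

definition frame_matrix :: "real^3^3" where
  "frame_matrix = (\<chi> i j. (if j = 1 then u0 else if j = 2 then e1 else e2) $ i)"

text \<open>Derivative of the frame coordinates of \<open>polar\<close>: rows belong to
  \<open>u0\<close>, \<open>e1\<close>, \<open>e2\<close>, columns to radius, height, angle. The
  second column contains the derivative -t / (D^2 s) of \<open>s\<close>.\<close>

definition jac :: "real^3 \<Rightarrow> real^3^3" where
  "jac x = vector [
     vector [x$2 / norm a, x$1 / norm a, 0],
     vector [s (x$2) * cos (x$3), - (x$1 * x$2 * cos (x$3) / ((norm a)\<^sup>2 * s (x$2))), - (x$1 * s (x$2) * sin (x$3))],
     vector [s (x$2) * sin (x$3), - (x$1 * x$2 * sin (x$3) / ((norm a)\<^sup>2 * s (x$2))), x$1 * s (x$2) * cos (x$3)]]"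

lemma frame_matrix_mult: "frame_matrix *v y = (y$1) *\<^sub>R u0 + (y$2) *\<^sub>R e1 + (y$3) *\<^sub>R e2"
  by (simp add: frame_matrix_def vec_eq_iff matrix_vector_mult_def sum_3 mult.commute)

lemma det_frame_matrix: "\<bar>det frame_matrix\<bar> = 1"
proof -
  have *: "sum (\<lambda>k. x $ k * y $ k) UNIV = x \<bullet> y" for x y :: "real^3"
    by (simp add: inner_vec_def)
  have "transpose frame_matrix ** frame_matrix = mat 1"
    using orthonormal
    by (auto simp: frame_matrix_def vec_eq_iff matrix_matrix_mult_def transpose_def mat_def forall_3 *)
  then have "orthogonal_matrix frame_matrix" by (simp add: orthogonal_matrix)
  then show ?thesis using det_orthogonal_matrix[of frame_matrix] by auto
qed

lemma det_jac:
  assumes "\<bar>x$2\<bar> < norm a"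
  shows "det (jac x) = - (x$1)\<^sup>2 / norm a"
proof -
  define S where "S = s (x$2)"
  define D where "D = norm a"
  define c where "c = cos (x$3)"
  define n where "n = sin (x$3)"
  have S: "S > 0" "S\<^sup>2 = 1 - (x$2)\<^sup>2 / D\<^sup>2" using assms s_pos s_sq by (auto simp: S_def D_def)
  have D: "D > 0" using norm_a by (simp add: D_def)
  have cn: "c\<^sup>2 + n\<^sup>2 = 1" by (simp add: c_def n_def)
  \<comment> \<open>The first bracket is 1 by the definition of \<open>s\<close>, the second by
    Pythagoras. The sign only reflects orientation.\<close>
  have "det (jac x) = - (x$1)\<^sup>2 / D * ((x$2)\<^sup>2 / D\<^sup>2 + S\<^sup>2) * (c\<^sup>2 + n\<^sup>2)"
    unfolding jac_def det_3 vector_3 S_def[symmetric] c_def[symmetric] n_def[symmetric] D_def[symmetric]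
    using S(1) D by (simp add: field_simps power2_eq_square)
  also have "\<dots> = - (x$1)\<^sup>2 / D" unfolding S(2) cn by simp
  finally show ?thesis by (simp add: D_def)
qed

lemma polar_deriv:
  assumes "\<bar>x$2\<bar> < norm a"
  shows "(polar has_derivative (\<lambda>h. frame_matrix *v (jac x *v h))) (at x within X)"
proof -
  note pos = s_arg_pos[OF assms] s_pos[OF assms]
  have c: "((\<lambda>x::real^3. x$i) has_derivative (\<lambda>h. h$i)) F" for i F
    by (intro bounded_linear_imp_has_derivative bounded_linear_vec_nth)
  have sd: "((\<lambda>x. s (x$2)) has_derivative (\<lambda>h. - (x$2 / ((norm a)\<^sup>2 * s (x$2))) * h$2)) (at x within X)"
  proof -
    have "(s has_real_derivative - (x$2 / ((norm a)\<^sup>2 * s (x$2)))) (at (x$2))"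
    proof -
      have 1: "((\<lambda>t. 1 - t\<^sup>2 / (norm a)\<^sup>2) has_real_derivative - (2 * x$2 / (norm a)\<^sup>2)) (at (x$2))"
        using norm_a by (auto intro!: derivative_eq_intros simp: field_simps power2_eq_square)
      \<comment> \<open>Brings the chain-rule expression for the derivative of \<open>s\<close> into
        the form used in \<open>jac\<close>; as division by zero gives 0, it holds for all q and
        n.\<close>
      have 2: "inverse q / 2 * - (2 * y / n) = - (y / (n * q))" for q y n :: real
        by (cases "q = 0"; cases "n = 0"; simp add: field_simps)
      show ?thesis
        using DERIV_chain2[OF DERIV_real_sqrt[OF pos(1)] 1] by (simp only: s_def[abs_def] 2)
    qed
    then have "(s has_derivative (\<lambda>h. - (x$2 / ((norm a)\<^sup>2 * s (x$2))) * h)) (at (x$2))"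
      by (simp only: has_field_derivative_def)
    from has_derivative_compose[OF c this] show ?thesis .
  qed
  have "((\<lambda>x. x$1 * (x$2 * inverse (norm a))) has_derivative (\<lambda>h. (jac x *v h)$1)) (at x within X)"
    "((\<lambda>x. x$1 * (s (x$2) * cos (x$3))) has_derivative (\<lambda>h. (jac x *v h)$2)) (at x within X)"
    "((\<lambda>x. x$1 * (s (x$2) * sin (x$3))) has_derivative (\<lambda>h. (jac x *v h)$3)) (at x within X)"
    by (rule derivative_eq_intros c sd refl
      | simp add: jac_def matrix_vector_mult_def sum_3 fun_eq_iff divide_inverse algebra_simps)+
  from this[THEN has_derivative_scaleR_left]
  have "((\<lambda>x. (x$1 * (x$2 * inverse (norm a))) *\<^sub>R u0 + (x$1 * (s (x$2) * cos (x$3))) *\<^sub>R e1 +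
      (x$1 * (s (x$2) * sin (x$3))) *\<^sub>R e2) has_derivative (\<lambda>h. frame_matrix *v (jac x *v h))) (at x within X)"
    unfolding frame_matrix_mult by (intro has_derivative_add)
  then show ?thesis
    by (simp add: polar_def[abs_def] chart_u0 scaleR_add_right divide_inverse)
qed

lemma abs_det_deriv:
  assumes "\<bar>x$2\<bar> < norm a"
  shows "\<bar>det (matrix (\<lambda>h. frame_matrix *v (jac x *v h)))\<bar> = (x$1)\<^sup>2 / norm a"
proof -
  have "matrix (\<lambda>h. frame_matrix *v (jac x *v h)) = frame_matrix ** jac x"
    by (simp add: matrix_vector_mul_assoc matrix_of_matrix_vector_mul)
  then show ?thesis
    using norm_a by (simp add: det_mul abs_mult det_frame_matrix det_jac[OF assms])
qed

lemma chart_notin_span: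
  assumes "\<bar>t\<bar> < norm a"
  shows "u t \<theta> \<notin> span {a}"
proof
  assume "u t \<theta> \<in> span {a}"
  then obtain k where "u t \<theta> = k *\<^sub>R norm a *\<^sub>R u0" using a_u0 by (auto simp: span_singleton)
  then have "e1 \<bullet> u t \<theta> = 0" "e2 \<bullet> u t \<theta> = 0" using orthonormal by simp_all
  then have "cos \<theta> = 0" "sin \<theta> = 0" using s_pos[OF assms] by (simp_all add: e1_chart e2_chart)
  then show False using sin_cos_squared_add[of \<theta>] by simp
qed

text \<open>Parameters are packed into \<open>real^3\<close> as radius, height and angle, so that
  \<open>polar\<close> maps this space to itself. Radius 0 is excluded because \<open>polar\<close>
  sends all such parameters to the origin.\<close>

definition param_dom :: "(real^3) set \<Rightarrow> (real^3) set" where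
  "param_dom A = {x. 0 < x$1 \<and> x$1 \<le> 1 \<and> (x$2, x$3) \<in> chart_box a \<and> u (x$2) (x$3) \<in> A}"

lemma polar_image: "polar ` param_dom A = solid_cone A - span {a}"
proof safe
  fix x assume "x \<in> param_dom A"
  then have x: "0 < x$1" "x$1 \<le> 1" "\<bar>x$2\<bar> < norm a" "u (x$2) (x$3) \<in> A"
    by (auto simp: param_dom_def chart_box_iff)
  have "norm (polar x) = x$1" using x(1) norm_chart[OF x(3)] by (simp add: polar_def)
  then show "polar x \<in> solid_cone A" using x by (auto simp: solid_cone_def polar_def)
  assume "polar x \<in> span {a}"
  then have "inverse (x$1) *\<^sub>R polar x \<in> span {a}" by (rule span_scale)
  then show False using x(1) chart_notin_span[OF x(3)] by (simp add: polar_def)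
next
  fix x assume x: "x \<in> solid_cone A" and nl: "x \<notin> span {a}"
  have "x /\<^sub>R norm x \<notin> span {a}"
  proof
    assume "x /\<^sub>R norm x \<in> span {a}"
    then have "norm x *\<^sub>R (x /\<^sub>R norm x) \<in> span {a}" by (rule span_scale)
    then show False using x nl by (simp add: solid_cone_def)
  qed
  moreover have "norm (x /\<^sub>R norm x) = 1" using x by (simp add: solid_cone_def)
  ultimately obtain t \<theta> where t: "(t, \<theta>) \<in> chart_box a" "u t \<theta> = x /\<^sub>R norm x"
    using chart_surj by metis
  show "x \<in> polar ` param_dom A"
  proof
    show "x = polar (vector [norm x, t, \<theta>])" using x t by (simp add: polar_def solid_cone_def)
    show "vector [norm x, t, \<theta>] \<in> param_dom A" using x t by (simp add: param_dom_def solid_cone_def)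
  qed
qed

lemma polar_inj: "inj_on polar (param_dom A)"
proof
  fix x y assume x: "x \<in> param_dom A" and y: "y \<in> param_dom A" and eq: "polar x = polar y"
  have "norm (polar z) = z$1" if "z \<in> param_dom A" for z
    using that norm_chart[of "z$2" "z$3"] by (auto simp: param_dom_def chart_box_iff polar_def)
  then have 1: "x$1 = y$1" using x y eq by metis
  then have "u (x$2) (x$3) = u (y$2) (y$3)" using eq x by (simp add: polar_def param_dom_def)
  then show "x = y"
    using 1 x y chart_inj[of "x$2" "x$3" "y$2" "y$3"] by (simp add: vec_eq_iff forall_3 param_dom_def)
qed

text \<open>The left side does not mention the frame, so the area on the right inherits the
  symmetries of Lebesgue measure. The constant is 1/D times the integral of the squared radius over
  the unit interval.\<close>

lemma solid_cone_volume:
  assumes [measurable]: "A \<in> sets borel"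
  shows "emeasure lborel (solid_cone A) =
    ennreal (1 / (3 * norm a)) * emeasure lborel {z \<in> chart_box a. u (fst z) (snd z) \<in> A}"
proof -
  let ?T = "{z \<in> chart_box a. u (fst z) (snd z) \<in> A}"
  let ?f = "\<lambda>x::real^3. (x$1)\<^sup>2 / norm a"
  have T [measurable]: "?T \<in> sets borel"
    using measurable_sets_borel[OF chart_borel[of a e1 e2] assms]
    by (auto simp: vimage_def Collect_conj_eq)
  have [measurable]: "(\<lambda>x::real^3. x$i) \<in> borel_measurable borel" for i
    by (intro borel_measurable_continuous_onI continuous_intros)
  have pd: "param_dom A = {x. x$1 \<in> {0<..1} \<and> (x$2, x$3) \<in> ?T}"
    by (auto simp: param_dom_def)
  have pdm [measurable]: "param_dom A \<in> sets borel"
    unfolding pd by measurable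
  have bnd: "bounded (param_dom A)"
  proof (rule boundedI)
    fix x assume "x \<in> param_dom A"
    then have "\<bar>x$1\<bar> \<le> 1" "\<bar>x$2\<bar> \<le> norm a" "\<bar>x$3\<bar> \<le> 2 * pi"
      by (auto simp: param_dom_def chart_box_iff)
    then show "norm x \<le> 1 + norm a + 2 * pi"
      using norm_le_l1_cart[of x] by (simp add: sum_3)
  qed
  have x2: "\<bar>x$2\<bar> < norm a" if "x \<in> param_dom A" for x
    using that by (simp add: param_dom_def chart_box_iff)
  have int: "?f integrable_on param_dom A"
  proof (rule set_borel_integral_eq_integral(1))
    show "set_integrable lborel (param_dom A) ?f"
      unfolding set_integrable_def real_scaleR_def
    proof (rule integrableI_bounded_set[where A = "param_dom A" and B = "1 / norm a"])
      show "emeasure lborel (param_dom A) < \<infinity>" using bnd by (rule emeasure_bounded_finite)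
      have "\<bar>?f x\<bar> \<le> 1 / norm a" if "x \<in> param_dom A" for x
        using that norm_a by (auto simp: param_dom_def intro!: divide_right_mono power_le_one)
      then show "AE x in lborel. x \<in> param_dom A \<longrightarrow> norm (indicator (param_dom A) x * ?f x) \<le> 1 / norm a"
        by (auto simp: abs_mult split: split_indicator)
    qed (auto split: split_indicator)
  qed
  have det: "\<bar>det (matrix (\<lambda>h. frame_matrix *v (jac x *v h)))\<bar> = ?f x" if "x \<in> param_dom A" for x
    by (rule abs_det_deriv) (rule x2[OF that])
  have "measure lebesgue (polar ` param_dom A)
      = integral (param_dom A) (\<lambda>x. \<bar>det (matrix (\<lambda>h. frame_matrix *v (jac x *v h)))\<bar>)"
    using int det polar_inj
    by (intro measure_differentiable_image_eq)
       (auto intro!: polar_deriv x2 intro: integrable_eq simp: pdm)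
  also have "\<dots> = integral (param_dom A) ?f"
    by (rule integral_cong) (rule det)
  finally have vol: "measure lebesgue (solid_cone A - span {a}) = integral (param_dom A) ?f"
    by (simp only: polar_image)
  \<comment> \<open>The axis, which the chart does not reach, has dimension 1 in a space of
    dimension 3.\<close>
  have line: "span {a} \<in> null_sets lebesgue"
    unfolding negligible_iff_null_sets[symmetric]
    by (intro negligible_lowdim) (simp add: dim_singleton)
  have lm: "solid_cone A - span {a} \<in> lmeasurable"
    by (intro bounded_set_imp_lmeasurable bounded_diff bounded_solid_cone)
       (use line solid_cone_borel[OF assms] in \<open>auto simp: null_sets_def\<close>)
  have "emeasure lborel (solid_cone A) = emeasure lebesgue (solid_cone A)"
    using solid_cone_borel[OF assms] by simp
  also have "\<dots> = emeasure lebesgue (solid_cone A - span {a})"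
    using solid_cone_borel[OF assms] line by (intro emeasure_Diff_null_set[symmetric]) auto
  also have "\<dots> = ennreal (integral (param_dom A) ?f)"
    using lm by (simp only: emeasure_eq_measure2 vol)
  also have "\<dots> = (\<integral>\<^sup>+x. indicator (param_dom A) x * ?f x \<partial>lborel)"
    by (rule nn_integral_has_integral_lebesgue[symmetric, OF _ integrable_integral[OF int]]) simp
  \<comment> \<open>The radial interval may be closed at 0 because the Jacobian vanishes there; this
    is the form that the fundamental theorem of calculus takes below.\<close>
  also have "\<dots> = (\<integral>\<^sup>+(x::real^3). (ennreal ((x$1)\<^sup>2 / norm a) * indicator {0..1} (x$1)) * indicator ?T (x$2, x$3) \<partial>lborel)"
    by (intro nn_integral_cong) (auto simp: pd split: split_indicator)
  also have "\<dots> = (\<integral>\<^sup>+r. ennreal (r\<^sup>2 / norm a) * indicator {0..1} r \<partial>lborel) * (\<integral>\<^sup>+z. indicator ?T z \<partial>lborel)"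
    by (rule nn_integral_lborel_vec3) auto
  also have "(\<integral>\<^sup>+r. ennreal (r\<^sup>2 / norm a) * indicator {0..1} r \<partial>lborel) = ennreal (1 ^ 3 / (3 * norm a) - 0 ^ 3 / (3 * norm a))"
    by (rule nn_integral_FTC_Icc) (use norm_a in \<open>auto intro!: derivative_eq_intros\<close>)
  finally show ?thesis by simp
qed

end

section \<open>The hat-box theorem\<close>

lemma integrable_scaleR_right_iff:
  fixes f :: "'a \<Rightarrow> 'b::{banach, second_countable_topology}"
  assumes "c \<noteq> 0"
  shows "integrable M (\<lambda>x. c *\<^sub>R f x) \<longleftrightarrow> integrable M f"
proof
  assume "integrable M (\<lambda>x. c *\<^sub>R f x)"
  then have "integrable M (\<lambda>x. inverse c *\<^sub>R c *\<^sub>R f x)" by (rule integrable_scaleR_right)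
  then show "integrable M f" using assms by simp
qed simp

context frame
begin

abbreviation unif_box :: "(real \<times> real) measure" where
  "unif_box \<equiv> density lborel (\<lambda>z. ennreal (indicator (chart_box a) z / (4 * pi * norm a)))"

lemma emeasure_distr_chart:
  assumes [measurable]: "A \<in> sets borel"
  shows "emeasure (distr unif_box borel (\<lambda>z. u (fst z) (snd z))) A =
    ennreal (1 / (4 * pi * norm a)) * emeasure lborel {z \<in> chart_box a. u (fst z) (snd z) \<in> A}"
proof -
  have T [measurable]: "(\<lambda>z. u (fst z) (snd z)) -` A \<in> sets borel"
    using measurable_sets_borel[OF chart_borel assms] .
  have "{z \<in> chart_box a. u (fst z) (snd z) \<in> A} = chart_box a \<inter> (\<lambda>z. u (fst z) (snd z)) -` A"
    by auto
  moreover have "emeasure (distr unif_box borel (\<lambda>z. u (fst z) (snd z))) A =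
      (\<integral>\<^sup>+z\<in>(\<lambda>z. u (fst z) (snd z)) -` A. ennreal (indicator (chart_box a) z / (4 * pi * norm a)) \<partial>lborel)"
    by (subst emeasure_distr) (auto simp: emeasure_density)
  moreover have "\<dots> = (\<integral>\<^sup>+z. ennreal (1 / (4 * pi * norm a)) * indicator (chart_box a \<inter> (\<lambda>z. u (fst z) (snd z)) -` A) z \<partial>lborel)"
    by (intro nn_integral_cong) (auto split: split_indicator)
  ultimately show ?thesis by (simp add: nn_integral_cmult_indicator)
qed

lemma prob_space_unif_box: "prob_space unif_box"
proof
  have "emeasure unif_box (space unif_box) = emeasure (distr unif_box borel (\<lambda>z. u (fst z) (snd z))) UNIV"
    by (subst emeasure_distr) auto
  also have "\<dots> = ennreal (1 / (4 * pi * norm a)) * ennreal (4 * pi * norm a)"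
    by (subst emeasure_distr_chart) (auto simp: emeasure_chart_box)
  also have "\<dots> = 1" using norm_a by (simp add: ennreal_mult[symmetric])
  finally show "emeasure unif_box (space unif_box) = 1" .
qed

text \<open>An orthogonal map taking \<open>v\<close> to \<open>w\<close> carries one cone onto the
  other. By \<open>solid_cone_volume\<close>, equal volumes become equal areas in the same
  rectangle; the frame stays fixed.\<close>

lemma distr_chart_ball:
  assumes v: "v \<in> S2" and w: "w \<in> S2"
  shows "emeasure (distr unif_box borel (\<lambda>z. u (fst z) (snd z))) (ball v r) =
    emeasure (distr unif_box borel (\<lambda>z. u (fst z) (snd z))) (ball w r)"
proof -
  obtain f where f: "orthogonal_transformation f" "f v = w"
    using rotation_exists[of v w] v w by auto
  have nf: "norm (f x) = norm x" for x using f(1) by (rule orthogonal_transformation_norm)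
  have lf: "linear f" using f(1) by (rule orthogonal_transformation_linear)
  have df: "dist (f x) (f y) = dist x y" for x y
    by (simp add: dist_norm linear_diff[OF lf, symmetric] nf)
  have f0: "f x = 0 \<longleftrightarrow> x = 0" for x using nf[of x] by (metis norm_eq_zero)
  have "f ` solid_cone (ball v r) = solid_cone (ball w r)"
  proof safe
    fix x assume "x \<in> solid_cone (ball v r)"
    then show "f x \<in> solid_cone (ball w r)"
      by (auto simp: solid_cone_def nf f0 linear_scale[OF lf, symmetric] df f(2)[symmetric])
  next
    fix y assume y: "y \<in> solid_cone (ball w r)"
    obtain x where x: "y = f x" using orthogonal_transformation_surj[OF f(1)] by auto
    then have "x \<in> solid_cone (ball v r)"
      using y by (auto simp: solid_cone_def nf f0 linear_scale[OF lf, symmetric] df f(2)[symmetric])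
    then show "y \<in> f ` solid_cone (ball v r)" using x by auto
  qed
  moreover have lm: "solid_cone (ball x r) \<in> lmeasurable" for x
    by (intro bounded_set_imp_lmeasurable bounded_solid_cone) (simp add: solid_cone_borel)
  ultimately have "emeasure lebesgue (solid_cone (ball v r)) = emeasure lebesgue (solid_cone (ball w r))"
    using measure_orthogonal_image[OF f(1) lm[of v]] by (simp add: emeasure_eq_measure2)
  then have "emeasure lborel (solid_cone (ball v r)) = emeasure lborel (solid_cone (ball w r))"
    using solid_cone_borel[of "ball v r"] solid_cone_borel[of "ball w r"] by simp
  then have "emeasure lborel {z \<in> chart_box a. u (fst z) (snd z) \<in> ball v r} =
      emeasure lborel {z \<in> chart_box a. u (fst z) (snd z) \<in> ball w r}"
    using norm_a by (simp add: solid_cone_volume ennreal_mult_cancel_left)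
  then show ?thesis by (simp add: emeasure_distr_chart)
qed

text \<open>\<open>\<sigma>\<close> has the sphere as its space. Transport along the identity makes
  it a Borel measure on all of \<open>real^3\<close>, concentrated on \<open>S2\<close>, comparable
  with the image of the rectangle.\<close>

lemma distr_chart_uniform:
  assumes \<sigma>: "rotation_invariant_prob \<sigma>"
  shows "distr \<sigma> borel (\<lambda>x. x) = distr unif_box borel (\<lambda>z. u (fst z) (snd z))"
proof (rule uniformly_distributed_measure_unique[where S = S2])
  have P: "prob_space \<sigma>" and S: "sets \<sigma> = sets (restrict_space borel S2)"
    and R: "\<And>Q. rotation_matrix Q \<Longrightarrow> distr \<sigma> \<sigma> (\<lambda>u. Q *v u) = \<sigma>"
    using \<sigma> by (auto simp: rotation_invariant_prob_def)
  have sp: "space \<sigma> = S2" using sets_eq_imp_space_eq[OF S] by (simp add: space_restrict_space)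
  have id: "(\<lambda>x. x) \<in> \<sigma> \<rightarrow>\<^sub>M borel"
    unfolding measurable_cong_sets[OF S refl] by (intro measurable_restrict_space1) simp
  show "prob_space (distr \<sigma> borel (\<lambda>x. x))" using P id by (rule prob_space.prob_space_distr)
  show "prob_space (distr unif_box borel (\<lambda>z. u (fst z) (snd z)))"
    using prob_space_unif_box by (rule prob_space.prob_space_distr) simp
  show "AE x in distr \<sigma> borel (\<lambda>x. x). x \<in> S2"
    by (subst AE_distr_iff[OF id]) (use AE_space[of \<sigma>] in \<open>auto simp: sp\<close>)
  show "AE x in distr unif_box borel (\<lambda>z. u (fst z) (snd z)). x \<in> S2"
    by (subst AE_distr_iff) (auto simp: AE_density chart_box_iff norm_chart split: split_indicator)
  show "emeasure (distr \<sigma> borel (\<lambda>x. x)) (ball v r) = emeasure (distr \<sigma> borel (\<lambda>x. x)) (ball w r)"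
    if v: "v \<in> S2" and w: "w \<in> S2" for v w r
  proof -
    \<comment> \<open>\<open>\<sigma>\<close> is assumed invariant under rotations only, so
      determinant 1 is required of the orthogonal map here.\<close>
    obtain f where f: "orthogonal_transformation f" "det (matrix f) = 1" "f v = w"
      using rotation_exists[of v w] v w by auto
    have lf: "linear f" using f(1) by (rule orthogonal_transformation_linear)
    have fm: "matrix f *v x = f x" for x by (simp add: lf)
    have nf: "norm (f x) = norm x" for x using f(1) by (rule orthogonal_transformation_norm)
    have rot: "rotation_matrix (matrix f)"
      using f by (simp add: rotation_matrix_def orthogonal_transformation_matrix)
    have mQ: "(\<lambda>x. matrix f *v x) \<in> \<sigma> \<rightarrow>\<^sub>M \<sigma>"
      unfolding measurable_cong_sets[OF S S]
      by (rule measurable_restrict_space3)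
         (auto simp: fm nf intro!: borel_measurable_continuous_onI linear_continuous_on linear_conv_bounded_linear[THEN iffD1] lf)
    have b: "ball x r \<inter> S2 \<in> sets \<sigma>" for x
      by (simp add: S sets_restrict_space_iff)
    have d: "emeasure (distr \<sigma> borel (\<lambda>x. x)) (ball x r) = emeasure \<sigma> (ball x r \<inter> S2)" for x
      by (subst emeasure_distr[OF id]) (auto simp: sp)
    have "emeasure \<sigma> (ball w r \<inter> S2) = emeasure (distr \<sigma> \<sigma> (\<lambda>x. matrix f *v x)) (ball w r \<inter> S2)"
      by (simp only: R[OF rot])
    also have "\<dots> = emeasure \<sigma> ((\<lambda>x. matrix f *v x) -` (ball w r \<inter> S2) \<inter> space \<sigma>)"
      by (rule emeasure_distr[OF mQ b])
    also have "(\<lambda>x. matrix f *v x) -` (ball w r \<inter> S2) \<inter> space \<sigma> = ball v r \<inter> S2"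
      by (auto simp: sp fm nf f(3)[symmetric] dist_norm linear_diff[OF lf, symmetric])
    finally show ?thesis by (simp only: d)
  qed
  show "emeasure (distr unif_box borel (\<lambda>z. u (fst z) (snd z))) (ball v r) =
    emeasure (distr unif_box borel (\<lambda>z. u (fst z) (snd z))) (ball w r)"
    if "v \<in> S2" "w \<in> S2" for v w r
    using that by (rule distr_chart_ball)
qed simp_all

text \<open>The constant is split into two factors because the sum over the cells pulls out 1 / (4 *
  pi) and keeps the other in each term.\<close>

lemma nn_integral_uniform_chart:
  assumes \<sigma>: "rotation_invariant_prob \<sigma>" and [measurable]: "h \<in> borel_measurable borel"
  shows "(\<integral>\<^sup>+x. h x \<partial>\<sigma>) = ennreal (1 / (4 * pi)) * (ennreal (1 / norm a) *
    (\<integral>\<^sup>+z\<in>chart_box a. h (u (fst z) (snd z)) \<partial>lborel))"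
proof -
  have "sets \<sigma> = sets (restrict_space borel S2)"
    using \<sigma> by (simp add: rotation_invariant_prob_def)
  then have [measurable]: "(\<lambda>x. x) \<in> \<sigma> \<rightarrow>\<^sub>M borel"
    by (subst measurable_cong_sets[OF _ refl]) (auto intro: measurable_restrict_space1)
  have "(\<integral>\<^sup>+x. h x \<partial>\<sigma>) = (\<integral>\<^sup>+x. h x \<partial>distr \<sigma> borel (\<lambda>x. x))"
    by (simp add: nn_integral_distr)
  also have "\<dots> = (\<integral>\<^sup>+z. ennreal (indicator (chart_box a) z / (4 * pi * norm a)) * h (u (fst z) (snd z)) \<partial>lborel)"
    by (simp add: distr_chart_uniform[OF \<sigma>] nn_integral_distr nn_integral_density)
  also have "\<dots> = (\<integral>\<^sup>+z. ennreal (1 / (4 * pi * norm a)) * (h (u (fst z) (snd z)) * indicator (chart_box a) z) \<partial>lborel)"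
    by (intro nn_integral_cong) (auto split: split_indicator)
  also have "\<dots> = ennreal (1 / (4 * pi * norm a)) * (\<integral>\<^sup>+z\<in>chart_box a. h (u (fst z) (snd z)) \<partial>lborel)"
    by (rule nn_integral_cmult) simp
  also have "ennreal (1 / (4 * pi * norm a)) = ennreal (1 / (4 * pi)) * ennreal (1 / norm a)"
    by (simp add: ennreal_mult[symmetric])
  finally show ?thesis by (simp add: mult.assoc)
qed

text \<open>The equality of integrals carries no integrability premise: by the equivalence, both
  sides fail to be integrable together, and both integrals are then 0.\<close>

lemma integral_uniform_chart:
  fixes h :: "real^3 \<Rightarrow> 'b::{banach, second_countable_topology}"
  assumes \<sigma>: "rotation_invariant_prob \<sigma>" and [measurable]: "h \<in> borel_measurable borel"
  shows "integrable \<sigma> h \<longleftrightarrow> set_integrable lborel (chart_box a) (\<lambda>z. h (u (fst z) (snd z)))"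
    and "(\<integral>x. h x \<partial>\<sigma>) = (1 / (4 * pi)) *\<^sub>R ((1 / norm a) *\<^sub>R
      (\<integral>z\<in>chart_box a. h (u (fst z) (snd z)) \<partial>lborel))"
proof -
  have "sets \<sigma> = sets (restrict_space borel S2)"
    using \<sigma> by (simp add: rotation_invariant_prob_def)
  then have [measurable]: "(\<lambda>x. x) \<in> \<sigma> \<rightarrow>\<^sub>M borel"
    by (subst measurable_cong_sets[OF _ refl]) (auto intro: measurable_restrict_space1)
  have eq: "(indicator (chart_box a) z / (4 * pi * norm a)) *\<^sub>R h (u (fst z) (snd z)) =
      (1 / (4 * pi * norm a)) *\<^sub>R (indicator (chart_box a) z *\<^sub>R h (u (fst z) (snd z)))" for z
    by simp
  have "integrable \<sigma> h \<longleftrightarrow> integrable (distr \<sigma> borel (\<lambda>x. x)) h"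
    by (simp add: integrable_distr_eq)
  also have "\<dots> \<longleftrightarrow> integrable lborel
      (\<lambda>z. (indicator (chart_box a) z / (4 * pi * norm a)) *\<^sub>R h (u (fst z) (snd z)))"
    by (simp add: distr_chart_uniform[OF \<sigma>] integrable_distr_eq integrable_density)
  also have "\<dots> \<longleftrightarrow> set_integrable lborel (chart_box a) (\<lambda>z. h (u (fst z) (snd z)))"
    using a_nz unfolding eq set_integrable_def by (subst integrable_scaleR_right_iff) simp_all
  finally show "integrable \<sigma> h \<longleftrightarrow> set_integrable lborel (chart_box a) (\<lambda>z. h (u (fst z) (snd z)))" .
  have "(\<integral>x. h x \<partial>\<sigma>) = (\<integral>x. h x \<partial>distr \<sigma> borel (\<lambda>x. x))"
    by (simp add: integral_distr)
  also have "\<dots> = (\<integral>z. (indicator (chart_box a) z / (4 * pi * norm a)) *\<^sub>R h (u (fst z) (snd z)) \<partial>lborel)"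
    by (simp add: distr_chart_uniform[OF \<sigma>] integral_distr integral_density)
  also have "\<dots> = (1 / (4 * pi * norm a)) *\<^sub>R (\<integral>z\<in>chart_box a. h (u (fst z) (snd z)) \<partial>lborel)"
    unfolding eq set_lebesgue_integral_def by (rule integral_scaleR_right)
  finally show "(\<integral>x. h x \<partial>\<sigma>) = (1 / (4 * pi)) *\<^sub>R ((1 / norm a) *\<^sub>R
      (\<integral>z\<in>chart_box a. h (u (fst z) (snd z)) \<partial>lborel))" by simp
qed

lemma chart_domain_iff: "z \<in> chart_domain a e1 e2 C \<longleftrightarrow> z \<in> chart_box a \<and> u (fst z) (snd z) \<in> int_S2 C"
  by (cases z) (auto simp: chart_domain_def chart_box_iff)

end

section \<open>Piecewise linear functions\<close>

lemma int_S2_borel [measurable]: "int_S2 C \<in> sets borel"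
proof -
  have "openin (top_of_set S2) (int_S2 C)" by simp
  then obtain T where "open T" "int_S2 C = S2 \<inter> T" unfolding openin_open by blast
  then show ?thesis by auto
qed

lemma int_S2_subset: "int_S2 C \<subseteq> S2"
  using interior_of_subset_topspace[of "top_of_set S2" C] by simp

text \<open>The random variable is kept out: its law is \<open>\<sigma>\<close>, so the work can be
  done for \<open>F\<close> on the sphere itself.\<close>

locale piecewise_linear =
  fixes \<sigma> :: "(real^3) measure"
    and \<C> :: "(real^3) set set"
    and F :: "real^3 \<Rightarrow> real"
    and a e1 e2 :: "(real^3) set \<Rightarrow> real^3"
  assumes sigma: "rotation_invariant_prob \<sigma>"
    and fin: "finite \<C>"
    and disj: "pairwise (\<lambda>C C'. disjnt (int_S2 C) (int_S2 C')) \<C>"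
    and cover: "emeasure \<sigma> (S2 - (\<Union>C\<in>\<C>. int_S2 C)) = 0"
    and F_meas: "F \<in> borel_measurable (restrict_space borel S2)"
    and a_nz: "\<And>C. C \<in> \<C> \<Longrightarrow> a C \<noteq> 0"
    and F_eq: "\<And>C u. C \<in> \<C> \<Longrightarrow> u \<in> int_S2 C \<Longrightarrow> F u = a C \<bullet> u"
    and basis: "\<And>C. C \<in> \<C> \<Longrightarrow> orthonormal_basis3 (a C /\<^sub>R norm (a C)) (e1 C) (e2 C)"
begin

lemma frame: "C \<in> \<C> \<Longrightarrow> frame (a C) (e1 C) (e2 C)"
  using a_nz basis by unfold_locales

lemma sets_sigma [measurable_cong]: "sets \<sigma> = sets (restrict_space borel S2)"
  using sigma by (simp add: rotation_invariant_prob_def)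

lemma space_sigma: "space \<sigma> = S2"
  using sets_eq_imp_space_eq[OF sets_sigma] by (simp add: space_restrict_space)

lemma F_borel_sigma [measurable]: "F \<in> borel_measurable \<sigma>"
  using F_meas by (simp cong: measurable_cong_sets add: sets_sigma)

lemma measurable_sigma: "h \<in> borel_measurable borel \<Longrightarrow> h \<in> borel_measurable \<sigma>"
  by (subst measurable_cong_sets[OF sets_sigma refl]) (rule measurable_restrict_space1)

lemma AE_cell: "AE u in \<sigma>. \<exists>C\<in>\<C>. u \<in> int_S2 C"
proof -
  have "S2 - (\<Union>C\<in>\<C>. int_S2 C) \<in> sets \<sigma>"
    using fin by (auto simp: sets_sigma sets_restrict_space_iff intro!: sets.Diff sets.finite_UN)
  then have "S2 - (\<Union>C\<in>\<C>. int_S2 C) \<in> null_sets \<sigma>"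
    using cover by auto
  from AE_not_in[OF this] show ?thesis
    using AE_space[of \<sigma>] by eventually_elim (auto simp: space_sigma)
qed

lemma unique_cell:
  assumes "C \<in> \<C>" "C' \<in> \<C>" "u \<in> int_S2 C" "u \<in> int_S2 C'"
  shows "C = C'"
  using disj assms by (auto simp: pairwise_def disjnt_iff)

text \<open>Disjointness of the interiors leaves a single nonzero term. The values lie in any
  commutative monoid, to cover both \<open>ennreal\<close> and Banach spaces.\<close>

lemma sum_cells:
  fixes f :: "(real^3) set \<Rightarrow> 'b::comm_monoid_add"
  assumes C: "C \<in> \<C>" "u \<in> int_S2 C" and f: "\<And>C'. u \<notin> int_S2 C' \<Longrightarrow> f C' = 0"
  shows "sum f \<C> = f C"
proof -
  have "sum f \<C> = sum f {C}"
  proof (rule sum.mono_neutral_right)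
    show "\<forall>C'\<in>\<C> - {C}. f C' = 0"
    proof
      fix C' assume "C' \<in> \<C> - {C}"
      then have "u \<notin> int_S2 C'" using unique_cell[OF C(1) _ C(2), of C'] by blast
      then show "f C' = 0" by (rule f)
    qed
  qed (use fin C(1) in auto)
  then show ?thesis by simp
qed

text \<open>\<open>F\<close> is measurable on the sphere only. The linear expressions cut off to the
  interiors are Borel on all of \<open>real^3\<close>, and to each of them the formula in the frame
  of its own cell applies.\<close>

lemma nn_integral_eq_rhs:
  assumes [measurable]: "g \<in> borel_measurable borel"
  shows "(\<integral>\<^sup>+u. g (F u) \<partial>\<sigma>) = rhs_nn \<C> a e1 e2 g"
proof -
  have h [measurable]: "(\<lambda>u. g (a C \<bullet> u) * indicator (int_S2 C) u) \<in> borel_measurable borel" for C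
    by measurable
  have "(\<integral>\<^sup>+u. g (F u) \<partial>\<sigma>) = (\<integral>\<^sup>+u. (\<Sum>C\<in>\<C>. g (a C \<bullet> u) * indicator (int_S2 C) u) \<partial>\<sigma>)"
  proof (rule nn_integral_cong_AE, use AE_cell in eventually_elim)
    fix u assume "\<exists>C\<in>\<C>. u \<in> int_S2 C"
    then obtain C where C: "C \<in> \<C>" "u \<in> int_S2 C" by auto
    show "g (F u) = (\<Sum>C\<in>\<C>. g (a C \<bullet> u) * indicator (int_S2 C) u)"
      by (subst sum_cells[OF C]) (simp_all add: C F_eq[OF C])
  qed
  also have "\<dots> = (\<Sum>C\<in>\<C>. \<integral>\<^sup>+u. g (a C \<bullet> u) * indicator (int_S2 C) u \<partial>\<sigma>)"
    by (rule nn_integral_sum) (rule measurable_sigma[OF h])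
  also have "\<dots> = (\<Sum>C\<in>\<C>. ennreal (1 / (4 * pi)) * (ennreal (1 / norm (a C)) *
       (\<integral>\<^sup>+z\<in>chart_domain (a C) (e1 C) (e2 C) C. g (fst z) \<partial>lborel)))"
  proof (rule sum.cong)
    fix C assume "C \<in> \<C>"
    then interpret frame "a C" "e1 C" "e2 C" by (rule frame)
    \<comment> \<open>In the frame of \<open>C\<close> the inner product with \<open>a C\<close> is
      the first chart coordinate, and the two indicators multiply to that of the chart
      domain.\<close>
    have dom: "g (a C \<bullet> u (fst z) (snd z)) * indicator (int_S2 C) (u (fst z) (snd z)) * indicator (chart_box (a C)) z =
        g (fst z) * indicator (chart_domain (a C) (e1 C) (e2 C) C) z" for z
      by (auto simp: a_chart chart_domain_iff split: split_indicator)
    show "(\<integral>\<^sup>+u. g (a C \<bullet> u) * indicator (int_S2 C) u \<partial>\<sigma>) =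
        ennreal (1 / (4 * pi)) * (ennreal (1 / norm (a C)) *
          (\<integral>\<^sup>+z\<in>chart_domain (a C) (e1 C) (e2 C) C. g (fst z) \<partial>lborel))"
      unfolding nn_integral_uniform_chart[OF sigma h] dom ..
  qed simp
  finally show ?thesis by (simp add: rhs_nn_def sum_distrib_left)
qed

lemma integral_eq_rhs:
  fixes g :: "real \<Rightarrow> 'b::{banach, second_countable_topology}"
  assumes [measurable]: "g \<in> borel_measurable borel" and int: "integrable \<sigma> (\<lambda>u. g (F u))"
  shows "rhs_integrable \<C> a e1 e2 g" "(\<integral>u. g (F u) \<partial>\<sigma>) = rhs \<C> a e1 e2 g"
proof -
  define h where "h C u = indicator (int_S2 C) u *\<^sub>R g (a C \<bullet> u)" for C u
  have h: "h C \<in> borel_measurable borel" for C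
    unfolding h_def by measurable
  \<comment> \<open>The term equals \<open>g (F u)\<close> on the interior of \<open>C\<close> and 0
    elsewhere, so it is dominated by the whole. The exchange of sum and integral rests on
    this.\<close>
  have int_h: "integrable \<sigma> (h C)" if "C \<in> \<C>" for C
    using int measurable_sigma[OF h]
    by (rule Bochner_Integration.integrable_bound)
       (auto simp: h_def F_eq[OF that] split: split_indicator)
  have dom: "indicator (chart_box (a C)) z *\<^sub>R h C (chart (a C) (e1 C) (e2 C) (fst z) (snd z)) =
      indicator (chart_domain (a C) (e1 C) (e2 C) C) z *\<^sub>R g (fst z)" if "C \<in> \<C>" for C z
  proof -
    interpret frame "a C" "e1 C" "e2 C" using that by (rule frame)
    show ?thesis by (auto simp: h_def a_chart chart_domain_iff split: split_indicator)
  qed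
  show "rhs_integrable \<C> a e1 e2 g"
    unfolding rhs_integrable_def
  proof
    fix C assume C: "C \<in> \<C>"
    then interpret frame "a C" "e1 C" "e2 C" by (rule frame)
    show "set_integrable lborel (chart_domain (a C) (e1 C) (e2 C) C) (\<lambda>z. g (fst z))"
      using int_h[OF C] unfolding integral_uniform_chart(1)[OF sigma h] set_integrable_def dom[OF C] .
  qed
  have "(\<integral>u. g (F u) \<partial>\<sigma>) = (\<integral>u. (\<Sum>C\<in>\<C>. h C u) \<partial>\<sigma>)"
  proof (rule integral_cong_AE)
    show "(\<lambda>u. \<Sum>C\<in>\<C>. h C u) \<in> borel_measurable \<sigma>"
      by (intro borel_measurable_sum measurable_sigma h)
    show "AE u in \<sigma>. g (F u) = (\<Sum>C\<in>\<C>. h C u)"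
      using AE_cell
    proof eventually_elim
      fix u assume "\<exists>C\<in>\<C>. u \<in> int_S2 C"
      then obtain C where C: "C \<in> \<C>" "u \<in> int_S2 C" by auto
      show "g (F u) = (\<Sum>C\<in>\<C>. h C u)"
        by (subst sum_cells[OF C]) (simp_all add: h_def C F_eq[OF C])
    qed
  qed simp
  also have "\<dots> = (\<Sum>C\<in>\<C>. \<integral>u. h C u \<partial>\<sigma>)"
    by (rule Bochner_Integration.integral_sum) (rule int_h)
  also have "\<dots> = (\<Sum>C\<in>\<C>. (1 / (4 * pi)) *\<^sub>R ((1 / norm (a C)) *\<^sub>R
       (\<integral>z\<in>chart_domain (a C) (e1 C) (e2 C) C. g (fst z) \<partial>lborel)))"
  proof (rule sum.cong)
    fix C assume C: "C \<in> \<C>"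
    then interpret frame "a C" "e1 C" "e2 C" by (rule frame)
    show "(\<integral>u. h C u \<partial>\<sigma>) = (1 / (4 * pi)) *\<^sub>R ((1 / norm (a C)) *\<^sub>R
       (\<integral>z\<in>chart_domain (a C) (e1 C) (e2 C) C. g (fst z) \<partial>lborel))"
      unfolding integral_uniform_chart(2)[OF sigma h] set_lebesgue_integral_def dom[OF C] ..
  qed simp
  finally show "(\<integral>u. g (F u) \<partial>\<sigma>) = rhs \<C> a e1 e2 g"
    by (simp add: rhs_def scaleR_sum_right)
qed

lemma integrable_iff_rhs:
  fixes g :: "real \<Rightarrow> 'b::{banach, second_countable_topology}"
  assumes [measurable]: "g \<in> borel_measurable borel"
  shows "integrable \<sigma> (\<lambda>u. g (F u)) \<longleftrightarrow> rhs_nn \<C> a e1 e2 (\<lambda>t. ennreal (norm (g t))) < \<infinity>"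
  by (simp add: integrable_iff_bounded nn_integral_eq_rhs[symmetric])

section \<open>Integrability of powers\<close>

lemma AE_F_bounded: "AE u in \<sigma>. \<bar>F u\<bar> \<le> (\<Sum>C\<in>\<C>. norm (a C))"
  using AE_cell
proof eventually_elim
  fix u assume "\<exists>C\<in>\<C>. u \<in> int_S2 C"
  then obtain C where C: "C \<in> \<C>" "u \<in> int_S2 C" by auto
  then have "norm u = 1" using int_S2_subset by force
  then have "\<bar>F u\<bar> \<le> norm (a C)"
    using Cauchy_Schwarz_ineq2[of "a C" u] by (simp add: F_eq[OF C])
  also have "\<dots> \<le> (\<Sum>C\<in>\<C>. norm (a C))" using C(1) fin by (intro member_le_sum) auto
  finally show "\<bar>F u\<bar> \<le> (\<Sum>C\<in>\<C>. norm (a C))" .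
qed

lemma abs_pow_borel [measurable]: "abs_pow r \<in> borel_measurable borel"
  unfolding abs_pow_def[abs_def] by measurable

lemma integrable_abs_pow:
  assumes "r \<ge> 0"
  shows "integrable \<sigma> (\<lambda>u. abs_pow r (F u))"
proof -
  interpret prob_space \<sigma> using sigma by (simp add: rotation_invariant_prob_def)
  show ?thesis
  proof (rule integrable_const_bound)
    \<comment> \<open>The 1 covers the exponent 0, the power of the bound on \<open>F\<close> covers
      positive exponents.\<close>
    show "AE u in \<sigma>. norm (abs_pow r (F u)) \<le> max 1 ((\<Sum>C\<in>\<C>. norm (a C)) powr r)"
      using AE_F_bounded
      by eventually_elim (use assms in \<open>auto simp: abs_pow_def le_max_iff_disj intro: powr_mono2\<close>)
  qed simp
qed

lemma integrable_powr:
  assumes m: "m > 0" "\<And>u. u \<in> S2 \<Longrightarrow> F u \<ge> m"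
  shows "integrable \<sigma> (\<lambda>u. F u powr r)"
proof -
  interpret prob_space \<sigma> using sigma by (simp add: rotation_invariant_prob_def)
  show ?thesis
  proof (rule integrable_const_bound)
    \<comment> \<open>The first summand bounds decreasing powers, where \<open>m\<close> keeps
      \<open>F\<close> away from the singularity at 0; the second bounds the others.\<close>
    show "AE u in \<sigma>. norm (F u powr r) \<le> m powr r + (\<Sum>C\<in>\<C>. norm (a C)) powr r"
      using AE_F_bounded AE_space
    proof eventually_elim
      fix u assume u: "\<bar>F u\<bar> \<le> (\<Sum>C\<in>\<C>. norm (a C))" "u \<in> space \<sigma>"
      then have mF: "m \<le> F u" using m(2) by (simp add: space_sigma)
      show "norm (F u powr r) \<le> m powr r + (\<Sum>C\<in>\<C>. norm (a C)) powr r"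
      proof (cases "r \<ge> 0")
        case True
        then have "F u powr r \<le> (\<Sum>C\<in>\<C>. norm (a C)) powr r"
          using u(1) mF m(1) by (intro powr_mono2) auto
        then show ?thesis by (simp add: add_increasing)
      next
        case False
        then have "F u powr r \<le> m powr r"
          using mF m(1) by (intro powr_mono2') auto
        then show ?thesis by (simp add: add_increasing2)
      qed
    qed
  qed simp
qed

end

theorem theorem6p1:
  fixes \<sigma> :: "(real^3) measure"
    and \<C> :: "(real^3) set set"
    and F :: "real^3 \<Rightarrow> real"
    and a e1 e2 :: "(real^3) set \<Rightarrow> real^3"
    and P :: "'w measure"
    and U :: "'w \<Rightarrow> real^3"
  assumes sigma: "rotation_invariant_prob \<sigma>"
    and fin: "finite \<C>"
    and cells: "\<And>C. C \<in> \<C> \<Longrightarrow> spherical_cell C"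
    and disj: "pairwise (\<lambda>C C'. disjnt (int_S2 C) (int_S2 C')) \<C>"
    and cover: "emeasure \<sigma> (S2 - (\<Union>C\<in>\<C>. int_S2 C)) = 0"
    and F_meas: "F \<in> borel_measurable (restrict_space borel S2)"
    and a_nz: "\<And>C. C \<in> \<C> \<Longrightarrow> a C \<noteq> 0"
    and F_eq: "\<And>C u. C \<in> \<C> \<Longrightarrow> u \<in> int_S2 C \<Longrightarrow> F u = a C \<bullet> u"
    and basis: "\<And>C. C \<in> \<C> \<Longrightarrow> orthonormal_basis3 (a C /\<^sub>R norm (a C)) (e1 C) (e2 C)"
    and prob: "prob_space P"
    and U_meas: "U \<in> P \<rightarrow>\<^sub>M \<sigma>"
    and U_unif: "distr P \<sigma> U = \<sigma>"
  shows "(\<forall>g :: real \<Rightarrow> ennreal. g \<in> borel_measurable borel \<longrightarrow>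
            (\<integral>\<^sup>+w. g (F (U w)) \<partial>P) = rhs_nn \<C> a e1 e2 g)
       \<and> (\<forall>g :: real \<Rightarrow> real. g \<in> borel_measurable borel \<longrightarrow>
            (integrable P (\<lambda>w. g (F (U w))) \<longleftrightarrow>
               rhs_nn \<C> a e1 e2 (\<lambda>t. ennreal \<bar>g t\<bar>) < \<infinity>) \<and>
            (integrable P (\<lambda>w. g (F (U w))) \<longrightarrow>
               rhs_integrable \<C> a e1 e2 g \<and>
               (\<integral>w. g (F (U w)) \<partial>P) = rhs \<C> a e1 e2 g))
       \<and> (\<forall>g :: real \<Rightarrow> complex. g \<in> borel_measurable borel \<longrightarrow>
            (integrable P (\<lambda>w. g (F (U w))) \<longleftrightarrow>
               rhs_nn \<C> a e1 e2 (\<lambda>t. ennreal (norm (g t))) < \<infinity>) \<and>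
            (integrable P (\<lambda>w. g (F (U w))) \<longrightarrow>
               rhs_integrable \<C> a e1 e2 g \<and>
               (\<integral>w. g (F (U w)) \<partial>P) = rhs \<C> a e1 e2 g))
       \<and> (\<forall>r\<ge>0.
            integrable P (\<lambda>w. abs_pow r (F (U w))) \<and>
            rhs_integrable \<C> a e1 e2 (abs_pow r) \<and>
            (\<integral>w. abs_pow r (F (U w)) \<partial>P) = rhs \<C> a e1 e2 (abs_pow r))
       \<and> (\<forall>m>0. (\<forall>u\<in>S2. F u \<ge> m) \<longrightarrow>
            (\<forall>r::real.
              integrable P (\<lambda>w. F (U w) powr r) \<and>
              rhs_integrable \<C> a e1 e2 (\<lambda>t. t powr r) \<and>
              (\<integral>w. F (U w) powr r \<partial>P) = rhs \<C> a e1 e2 (\<lambda>t. t powr r)))"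
proof -
  interpret piecewise_linear \<sigma> \<C> F a e1 e2
    using sigma fin disj cover F_meas a_nz F_eq basis by unfold_locales
  \<comment> \<open>As \<open>\<sigma>\<close> is the law of \<open>U\<close>, integrals over
    \<open>P\<close> become integrals over the sphere.\<close>
  have nn: "(\<integral>\<^sup>+w. g (F (U w)) \<partial>P) = (\<integral>\<^sup>+u. g (F u) \<partial>\<sigma>)"
    if [measurable]: "g \<in> borel_measurable borel" for g :: "real \<Rightarrow> ennreal"
    using nn_integral_distr[OF U_meas, of "\<lambda>u. g (F u)"] by (simp add: U_unif)
  have real: "integrable P (\<lambda>w. g (F (U w))) \<longleftrightarrow> integrable \<sigma> (\<lambda>u. g (F u))"
      "(\<integral>w. g (F (U w)) \<partial>P) = (\<integral>u. g (F u) \<partial>\<sigma>)"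
    if [measurable]: "g \<in> borel_measurable borel" for g :: "real \<Rightarrow> real"
    using integrable_distr_eq[OF U_meas, of "\<lambda>u. g (F u)"] integral_distr[OF U_meas, of "\<lambda>u. g (F u)"]
    by (simp_all add: U_unif)
  have cplx: "integrable P (\<lambda>w. g (F (U w))) \<longleftrightarrow> integrable \<sigma> (\<lambda>u. g (F u))"
      "(\<integral>w. g (F (U w)) \<partial>P) = (\<integral>u. g (F u) \<partial>\<sigma>)"
    if [measurable]: "g \<in> borel_measurable borel" for g :: "real \<Rightarrow> complex"
    using integrable_distr_eq[OF U_meas, of "\<lambda>u. g (F u)"] integral_distr[OF U_meas, of "\<lambda>u. g (F u)"]
    by (simp_all add: U_unif)
  have powr_borel: "(\<lambda>t. t powr r) \<in> borel_measurable borel" for r :: real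
    by measurable
  have abs_pow: "\<forall>r\<ge>0. integrable P (\<lambda>w. abs_pow r (F (U w))) \<and> rhs_integrable \<C> a e1 e2 (abs_pow r) \<and>
      (\<integral>w. abs_pow r (F (U w)) \<partial>P) = rhs \<C> a e1 e2 (abs_pow r)"
    unfolding real[OF abs_pow_borel]
    using integrable_abs_pow integral_eq_rhs[OF abs_pow_borel integrable_abs_pow] by blast
  \<comment> \<open>On every chart domain t is a value of \<open>F\<close>, so t \<ge> m > 0 and
    \<open>t powr r\<close> is the ordinary power there, also for r = 0.\<close>
  have powr: "\<forall>m>0. (\<forall>u\<in>S2. F u \<ge> m) \<longrightarrow>
      (\<forall>r::real. integrable P (\<lambda>w. F (U w) powr r) \<and> rhs_integrable \<C> a e1 e2 (\<lambda>t. t powr r) \<and>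
        (\<integral>w. F (U w) powr r \<partial>P) = rhs \<C> a e1 e2 (\<lambda>t. t powr r))"
    unfolding real[OF powr_borel]
    using integrable_powr integral_eq_rhs[OF powr_borel integrable_powr] by blast
  show ?thesis
    by (intro conjI abs_pow powr)
       (simp_all add: nn real cplx nn_integral_eq_rhs integrable_iff_rhs integral_eq_rhs)
qed

end
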